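(* When $N\to\infty$, we have $$\sup_{f\in\mathcal{D}_N\setminus\{0\}}\frac{\|f\|_\infty}{\|f\|_{\mathfrak{B}}}\sim\log\log N,$$ $$\sup_{f\in\mathcal{D}_N\setminus\{0\}}\frac{\|f\|_{\mathrm{BMOA}}}{\|f\|_{\mathfrak{B}}}\asymp\sqrt{\log\log N},$$ $$\sup_{f\in\mathcal{D}_N\setminus\{0\}}\frac{\|f\|_\infty}{\|f\|_{\mathrm{BMOA}}}\asymp\log\log N.$$
   Context: $\mathcal{D}_N$ is the space of Dirichlet polynomials $f(s)=\sum_{n=2}^Na_nn^{-s}$, $a_n\in\mathbb{C}$ (Dirichlet polynomials of length $N$ vanishing at $+\infty$). $\|f\|_\infty:=\sup_{\operatorname{Re}s>0}|f(s)|$. The Bloch norm is $\|f\|_{\mathfrak{B}}:=\sup_{\sigma>0,\,t\in\mathbb{R}}\sigma|f'(\sigma+it)|$. Here $$\|f\|_{\mathrm{BMOA}}^2:=\sup_{h>0}\frac1h\sup_{t\in\mathbb{R}}\int_0^h\int_t^{t+h}|f'(\sigma+i\tau)|^2\,\sigma\,d\tau\,d\sigma.$$ $A(N)\sim B(N)$ means $A(N)/B(N)\to1$; $A(N)\asymp B(N)$ means that $c B(N)\le A(N)\le C B(N)$ for absolute constants $0<c\le C$ and all sufficiently large $N$. *)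

theory Defs
  imports "HOL-Analysis.Analysis"
begin

text \<open>
  All norms, and all suprema of quotients of norms, take values in \<^typ>\<open>ennreal\<close>, so that every
  supremum is the true one: it is infinite when the set is unbounded, whereas the supremum of an
  unbounded set of reals would be an unspecified real number.
\<close>

definition dirichlet_polys :: "nat \<Rightarrow> (complex \<Rightarrow> complex) set" where
  "dirichlet_polys N = {f. \<exists>a :: nat \<Rightarrow> complex. f = (\<lambda>s. \<Sum>n=2..N. a n * of_nat n powr (- s))}"

definition sup_norm :: "(complex \<Rightarrow> complex) \<Rightarrow> ennreal" where
  "sup_norm f = (SUP s\<in>{s. Re s > 0}. ennreal (cmod (f s)))"

definition bloch_norm :: "(complex \<Rightarrow> complex) \<Rightarrow> ennreal" where
  "bloch_norm f = (SUP \<sigma>\<in>{0<..}. SUP t. ennreal (\<sigma> * cmod (deriv f (Complex \<sigma> t))))"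

definition ennreal_sqrt :: "ennreal \<Rightarrow> ennreal" where
  "ennreal_sqrt x = (if x = \<infinity> then \<infinity> else ennreal (sqrt (enn2real x)))"

definition bmoa_norm_sq :: "(complex \<Rightarrow> complex) \<Rightarrow> ennreal" where
  "bmoa_norm_sq f = (SUP h\<in>{0<..}. ennreal (1 / h) *
     (SUP t. \<integral>\<^sup>+\<sigma>\<in>{0..h}. (\<integral>\<^sup>+\<tau>\<in>{t..t+h}. ennreal ((cmod (deriv f (Complex \<sigma> \<tau>)))\<^sup>2 * \<sigma>) \<partial>lborel) \<partial>lborel))"

definition bmoa_norm :: "(complex \<Rightarrow> complex) \<Rightarrow> ennreal" where
  "bmoa_norm f = ennreal_sqrt (bmoa_norm_sq f)"

text \<open>
  The library's asymptotic relations are confined to functions with values in a normed field.  The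
  two relations below compare a possibly infinite quantity with a real one that is eventually
  positive; each of them forces the left-hand side to be eventually finite.
\<close>

definition ennreal_asymp_equiv :: "(nat \<Rightarrow> ennreal) \<Rightarrow> (nat \<Rightarrow> real) \<Rightarrow> bool" where
  "ennreal_asymp_equiv A B \<longleftrightarrow> (\<lambda>N. A N / ennreal (B N)) \<longlonglongrightarrow> 1"

definition ennreal_same_order :: "(nat \<Rightarrow> ennreal) \<Rightarrow> (nat \<Rightarrow> real) \<Rightarrow> bool" where
  "ennreal_same_order A B \<longleftrightarrow>
     (\<exists>c C :: real. 0 < c \<and> c \<le> C \<and>
        (\<forall>\<^sub>F N in sequentially. ennreal (c * B N) \<le> A N \<and> A N \<le> ennreal (C * B N)))"

end

theory Submission
  imports Defs "HOL-Complex_Analysis.Complex_Analysis"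
begin

text \<open>
  Let \<open>L = ln N\<close> and let \<open>f\<close> have Bloch norm \<open>M\<close>. Since the frequencies of \<open>f'\<close> lie in
  \<open>[ln 2, L]\<close>, the maximum principle in a half-plane turns \<open>\<bar>f'\<bar> \<le> M / \<sigma>\<close> into
  \<open>\<bar>f'\<bar> \<le> 3 * M * L\<close> for \<open>\<sigma> \<le> 1 / L\<close> and into exponential decay for \<open>\<sigma> \<ge> 1\<close>. Integrating
  along horizontal lines, only \<open>1 / L \<le> \<sigma> \<le> 1\<close> contributes more than a bounded multiple of \<open>M\<close>, and
  it contributes \<open>M * ln L\<close>; the same bounds give \<open>M\<^sup>2 * ln L\<close>, up to a constant, for the square of the
  BMOA norm. The Bloch norm is dominated by the BMOA norm because \<open>(f')\<^sup>2\<close> satisfies an area mean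
  value inequality.

  All lower bounds come from polynomials in \<open>2 powr (- s)\<close>. The partial sums of the logarithm,
  \<open>\<Sum>j\<le>K. 2 powr (- j * s) / j\<close>, have Bloch norm at most 1 and bounded BMOA norm, but equal the
  harmonic number of \<open>K \<approx> log 2 N\<close> at the origin. The lacunary polynomial
  \<open>\<Sum>k<K. 2 powr (- (2 ^ k) * s)\<close> has bounded Bloch norm, and by orthogonality over a period its
  squared BMOA norm is at least a multiple of \<open>K \<approx> log 2 (log 2 N)\<close>.
\<close>

section \<open>Exponential sums in a half-plane\<close>

text \<open>A Phragmen-Lindelof argument: dividing \<open>F\<close> by \<open>1 + e * z\<close>
  makes it small far away, so the maximum principle on a large half-disc applies, and then
  \<open>e\<close> tends to 0. The bound \<open>K\<close> enters only through the radius of the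
  half-disc.\<close>

lemma half_plane_maximum_principle:
  assumes holF: "F holomorphic_on UNIV"
    and bdd: "\<And>s. Re s \<ge> 0 \<Longrightarrow> cmod (F s) \<le> K"
    and bnd: "\<And>t. cmod (F (Complex 0 t)) \<le> B"
    and s: "Re s \<ge> 0"
  shows "cmod (F s) \<le> B"
proof (cases "Re s = 0")
  case True
  then show ?thesis using bnd[of "Im s"] by (metis complex_surj)
next
  case False
  with s have s: "Re s > 0" by simp
  have B: "B \<ge> 0" using bnd[of 0] norm_ge_zero order_trans by blast
  have *: "cmod (F s) \<le> (B + e) * cmod (1 + of_real e * s)" if e: "e > 0" for e :: real
  proof -
    \<comment> \<open>The half-disc has to contain \<open>s\<close>, and on its arc
      \<open>e * R * (B + e)\<close> has to reach \<open>K\<close>. Using \<open>B + e\<close>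
      instead of \<open>B\<close> keeps the denominator positive when \<open>B = 0\<close>.\<close>
    define R where "R = max (cmod s + 1) (K / (e * (B + e)))"
    define S where "S = {z. Re z > 0} \<inter> ball 0 R"
    have re: "cmod (1 + of_real e * z) \<ge> 1" "cmod (1 + of_real e * z) \<ge> e * cmod z"
      if "Re z \<ge> 0" for z
    proof -
      have "1 \<le> Re (1 + of_real e * z)" using that e by simp
      also have "\<dots> \<le> cmod (1 + of_real e * z)" by (rule complex_Re_le_cmod)
      finally show "cmod (1 + of_real e * z) \<ge> 1" .
      have "(e * cmod z)\<^sup>2 \<le> (cmod (1 + of_real e * z))\<^sup>2"
        using that e by (simp add: cmod_power2 power_mult_distrib algebra_simps)
          (simp add: power2_eq_square algebra_simps)
      then show "cmod (1 + of_real e * z) \<ge> e * cmod z" by (rule power2_le_imp_le) simp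
    qed
    have nz: "1 + of_real e * z \<noteq> 0" if "Re z \<ge> 0" for z
      using re(1)[OF that] by force
    have R: "R > 0" "cmod s < R" "K / (e * (B + e)) \<le> R"
      unfolding R_def by (auto simp: max_def) (smt (verit) norm_ge_zero)+
    have "open S" unfolding S_def by (intro open_Int open_halfspace_Re_gt open_ball)
    have cl: "closure S \<subseteq> {z. Re z \<ge> 0} \<inter> cball 0 R"
      by (rule closure_minimal) (auto simp: S_def intro!: closed_Int closed_halfspace_Re_ge)
    have "cmod (F s / (1 + of_real e * s)) \<le> B + e"
    proof (rule maximum_modulus_frontier[of "\<lambda>z. F z / (1 + of_real e * z)" S])
      show "(\<lambda>z. F z / (1 + of_real e * z)) holomorphic_on interior S"
        by (intro holomorphic_intros holomorphic_on_subset[OF holF])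
          (use interior_subset nz in \<open>fastforce simp: S_def\<close>)+
      have "continuous_on (closure S) F"
        using holF holomorphic_on_imp_continuous_on continuous_on_subset by blast
      then show "continuous_on (closure S) (\<lambda>z. F z / (1 + of_real e * z))"
        by (intro continuous_intros) (use cl nz in auto)
      show "bounded S" unfolding S_def by auto
      show "s \<in> S" using s R by (simp add: S_def)
      show "cmod (F z / (1 + of_real e * z)) \<le> B + e" if z: "z \<in> frontier S" for z
      proof -
        have zc: "Re z \<ge> 0" "cmod z \<le> R" using z cl by (auto simp: frontier_def)
        have zn: "z \<notin> S" using z \<open>open S\<close> by (simp add: frontier_def interior_open)
        note re = re[OF zc(1)]
        show ?thesis
        proof (cases "Re z = 0")
          case True
          then have "cmod (F z) \<le> B" using bnd[of "Im z"] by (metis complex_surj)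
          also have "B \<le> (B + e) * cmod (1 + of_real e * z)"
            using mult_mono[of B "B+e" 1 "cmod (1 + of_real e * z)"] B e re by simp
          finally show ?thesis
            using re B e by (simp add: norm_divide divide_le_eq mult.commute)
        next
          case False
          then have "cmod z = R" using zn zc by (auto simp: S_def)
          have "cmod (F z) \<le> K" using bdd zc by auto
          also have "K \<le> (B + e) * (e * R)"
            using R(3) e B pos_divide_le_eq[of "e * (B + e)" K R] by (simp add: mult_ac)
          also have "\<dots> \<le> (B + e) * cmod (1 + of_real e * z)"
            using re \<open>cmod z = R\<close> B e by (intro mult_left_mono) auto
          finally show ?thesis
            using re B e by (simp add: norm_divide divide_le_eq mult.commute)
        qed
      qed
    qed
    then show ?thesis
      using nz[of s] s by (simp add: norm_divide divide_le_eq)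
  qed
  have "((\<lambda>e. (B + e) * cmod (1 + of_real e * s)) \<longlongrightarrow> (B + 0) * cmod (1 + of_real 0 * s)) (at_right 0)"
    by (intro tendsto_intros)
  then have "((\<lambda>e. (B + e) * cmod (1 + of_real e * s)) \<longlongrightarrow> B) (at_right 0)" by simp
  moreover have "eventually (\<lambda>e. cmod (F s) \<le> (B + e) * cmod (1 + of_real e * s)) (at_right 0)"
    using * by (auto simp: eventually_at_filter)
  ultimately show ?thesis
    by (rule tendsto_lowerbound) simp
qed

text \<open>A generalized Dirichlet polynomial. With an arbitrary index set and arbitrary real
  frequencies, one class contains the Dirichlet polynomials (\<open>l n = ln n\<close>), the
  extremal examples (\<open>l j = j * ln 2\<close>) and all their derivatives.\<close>

definition exp_sum :: "'a set \<Rightarrow> ('a \<Rightarrow> complex) \<Rightarrow> ('a \<Rightarrow> real) \<Rightarrow> complex \<Rightarrow> complex" where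
  "exp_sum A c l s = (\<Sum>k\<in>A. c k * exp (- (of_real (l k) * s)))"

lemma exp_sum_has_field_derivative:
  "(exp_sum A c l has_field_derivative exp_sum A (\<lambda>k. - of_real (l k) * c k) l s) (at s within S)"
  unfolding exp_sum_def
  by (rule derivative_eq_intros DERIV_sum | rule refl | simp add: algebra_simps sum_negf)+

lemma deriv_exp_sum: "deriv (exp_sum A c l) = exp_sum A (\<lambda>k. - of_real (l k) * c k) l"
  by (rule ext) (rule DERIV_imp_deriv[OF exp_sum_has_field_derivative])

lemma holomorphic_on_exp_sum: "exp_sum A c l holomorphic_on S"
  unfolding holomorphic_on_def field_differentiable_def
  using exp_sum_has_field_derivative by blast

lemma continuous_on_exp_sum [continuous_intros]:
  "continuous_on S g \<Longrightarrow> continuous_on S (\<lambda>x. exp_sum A c l (g x))"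
  unfolding exp_sum_def by (intro continuous_intros)

lemma norm_exp_of_real_mult: "cmod (exp (- (of_real a * s))) = exp (- (a * Re s))"
  by (simp add: norm_exp_eq_Re)

lemma norm_exp_sum_le: "cmod (exp_sum A c l s) \<le> (\<Sum>k\<in>A. cmod (c k) * exp (- (l k * Re s)))"
  unfolding exp_sum_def
  by (rule order_trans[OF norm_sum]) (simp add: norm_mult norm_exp_of_real_mult)

text \<open>After multiplication by \<open>exp (m * z)\<close> all frequencies are
  \<open>l k - m \<ge> 0\<close>, so the translated sum is bounded on the right half-plane and the
  maximum principle applies to it.\<close>

lemma exp_sum_decay_right:
  assumes l: "\<And>k. k \<in> A \<Longrightarrow> m \<le> l k"
    and B: "\<And>t. cmod (exp_sum A c l (Complex x t)) \<le> B"
    and s: "x \<le> Re s"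
  shows "cmod (exp_sum A c l s) \<le> B * exp (- m * (Re s - x))"
proof -
  define F where "F z = exp (of_real m * z) * exp_sum A c l (of_real x + z)" for z
  have F_eq: "F z = exp_sum A (\<lambda>k. c k * exp (- of_real (l k * x))) (\<lambda>k. l k - m) z" for z
    unfolding F_def exp_sum_def sum_distrib_left
    by (rule sum.cong) (auto simp: mult_exp_exp algebra_simps simp flip: exp_add)
  have "cmod (F (s - of_real x)) \<le> B"
  proof (rule half_plane_maximum_principle[of F])
    show "F holomorphic_on UNIV" unfolding F_eq[abs_def] by (rule holomorphic_on_exp_sum)
    show "cmod (F z) \<le> (\<Sum>k\<in>A. cmod (c k * exp (- of_real (l k * x))))" if "Re z \<ge> 0" for z
    proof -
      have "cmod (F z) \<le> (\<Sum>k\<in>A. cmod (c k * exp (- of_real (l k * x))) * exp (- ((l k - m) * Re z)))"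
        unfolding F_eq by (rule norm_exp_sum_le)
      also have "\<dots> \<le> (\<Sum>k\<in>A. cmod (c k * exp (- of_real (l k * x))))"
        using l that by (intro sum_mono mult_left_le) (auto simp: zero_le_mult_iff)
      finally show ?thesis .
    qed
    show "cmod (F (Complex 0 t)) \<le> B" for t
    proof -
      have "of_real x + Complex 0 t = Complex x t" by (simp add: complex_eq_iff)
      then show ?thesis using B[of t] by (simp add: F_def norm_mult norm_exp_eq_Re)
    qed
    show "Re (s - of_real x) \<ge> 0" using s by simp
  qed
  then have "exp (m * (Re s - x)) * cmod (exp_sum A c l s) \<le> B"
    by (simp add: F_def norm_mult)
  then show ?thesis by (simp add: exp_diff exp_minus field_simps)
qed

text \<open>The reflection \<open>s \<mapsto> - s\<close> negates the frequencies and exchanges left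
  and right, so an upper bound \<open>m\<close> on the frequencies becomes the lower bound
  \<open>- m\<close>.\<close>

lemma exp_sum_decay_left:
  assumes l: "\<And>k. k \<in> A \<Longrightarrow> l k \<le> m"
    and B: "\<And>t. cmod (exp_sum A c l (Complex x t)) \<le> B"
    and s: "Re s \<le> x"
  shows "cmod (exp_sum A c l s) \<le> B * exp (m * (x - Re s))"
proof -
  have neg: "exp_sum A c (\<lambda>k. - l k) (- z) = exp_sum A c l z" for z by (simp add: exp_sum_def)
  have "cmod (exp_sum A c (\<lambda>k. - l k) (- s)) \<le> B * exp (- (- m) * (Re (- s) - (- x)))"
  proof (rule exp_sum_decay_right)
    show "cmod (exp_sum A c (\<lambda>k. - l k) (Complex (- x) t)) \<le> B" for t
    proof -
      have "- Complex x (- t) = Complex (- x) t" by (simp add: complex_eq_iff)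
      then show ?thesis using B[of "- t"] neg[of "Complex x (- t)"] by simp
    qed
  qed (use l s in auto)
  then show ?thesis by (simp add: neg)
qed

section \<open>Dirichlet polynomials as exponential sums\<close>

lemma dirichlet_polysE:
  assumes "f \<in> dirichlet_polys N"
  obtains c where "f = exp_sum {2..N} c (\<lambda>n. ln (real n))"
proof -
  obtain a where a: "f = (\<lambda>s. \<Sum>n=2..N. a n * of_nat n powr (- s))"
    using assms by (auto simp: dirichlet_polys_def)
  have "f = exp_sum {2..N} a (\<lambda>n. ln (real n))"
    unfolding a exp_sum_def
    by (rule ext, rule sum.cong) (auto simp: powr_def mult.commute simp flip: Ln_of_nat)
  then show ?thesis by (rule that)
qed

lemma exp_sum_powers_of_two_mem_dirichlet_polys:
  assumes "finite J" and J: "\<And>j. j \<in> J \<Longrightarrow> 1 \<le> j \<and> 2 ^ j \<le> N"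
  shows "exp_sum J c (\<lambda>j. real j * ln 2) \<in> dirichlet_polys N"
proof -
  \<comment> \<open>At most one \<open>j\<close> satisfies \<open>2 ^ j = n\<close>; summing over
    this fibre gives 0 automatically when there is none.\<close>
  define a where "a n = (\<Sum>j\<in>{j\<in>J. 2 ^ j = n}. c j)" for n :: nat
  have "exp_sum J c (\<lambda>j. real j * ln 2) s = (\<Sum>n=2..N. a n * of_nat n powr (- s))" for s
  proof -
    have "(\<Sum>n=2..N. a n * of_nat n powr (- s))
        = (\<Sum>n=2..N. \<Sum>j\<in>{j\<in>J. 2 ^ j = n}. c j * exp (- (of_real (real j * ln 2) * s)))"
      unfolding a_def sum_distrib_right
    proof (intro sum.cong refl)
      fix n j assume "n \<in> {2..N}" "j \<in> {j \<in> J. 2 ^ j = n}"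
      then have n: "n = 2 ^ j" by simp
      have "Ln (of_nat n :: complex) = of_real (real j * ln 2)"
        unfolding n by (subst Ln_of_nat) (simp_all add: ln_realpow)
      then show "c j * of_nat n powr (- s) = c j * exp (- (of_real (real j * ln 2) * s))"
        by (simp add: powr_def n mult.commute)
    qed
    also have "\<dots> = (\<Sum>j\<in>J. c j * exp (- (of_real (real j * ln 2) * s)))"
    proof (rule sum.group)
      show "(\<lambda>j. 2 ^ j) ` J \<subseteq> {2..N}"
      proof clarsimp
        fix j assume "j \<in> J"
        then show "2 \<le> (2::nat) ^ j \<and> 2 ^ j \<le> N"
          using J[of j] self_le_power[of "2::nat" j] by auto
      qed
    qed (use assms in auto)
    finally show ?thesis by (simp add: exp_sum_def)
  qed
  then show ?thesis by (auto simp: dirichlet_polys_def)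
qed

section \<open>An area mean value inequality on squares\<close>

lemma norm_contour_integral_horizontal_le:
  assumes "a < b" and cont: "continuous_on {a..b} (\<lambda>x. f (Complex x c))"
  shows "cmod (contour_integral (linepath (Complex a c) (Complex b c)) f)
           \<le> integral {a..b} (\<lambda>x. cmod (f (Complex x c)))"
proof -
  have "contour_integral (linepath (Complex a c) (Complex b c)) f
      = of_real (b - a) * integral {0..1} (\<lambda>x. f (linepath (Complex a c) (Complex b c) x))"
  proof -
    have "Complex b c - Complex a c = of_real (b - a)" by (simp add: complex_eq_iff)
    then show ?thesis by (simp add: contour_integral_integral mult.commute del: of_real_diff)
  qed
  also have "(\<lambda>x. f (linepath (Complex a c) (Complex b c) x)) = (\<lambda>x. f (Complex ((b - a) * x + a) c))"
    by (rule ext, rule arg_cong[of _ _ f]) (simp add: linepath_def complex_eq_iff algebra_simps)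
  also have "integral {0..1} \<dots> = integral {a..b} (\<lambda>x. f (Complex x c)) / of_real (b - a)"
  proof -
    have "((\<lambda>x. f (Complex x c)) has_integral integral {a..b} (\<lambda>x. f (Complex x c))) (cbox a b)"
      using integrable_continuous_real[OF cont] by (simp add: integrable_integral)
    moreover have "(\<lambda>x. (1 / (b - a)) *\<^sub>R x + - ((1 / (b - a)) *\<^sub>R a)) ` cbox a b = {0..1}"
      using image_affinity_atLeastAtMost[of "1 / (b - a)" "- (a / (b - a))" a b] \<open>a < b\<close>
      by (simp flip: diff_divide_distrib)
    ultimately have "((\<lambda>x. f (Complex ((b - a) * x + a) c)) has_integral
             (1 / (b - a)) *\<^sub>R integral {a..b} (\<lambda>x. f (Complex x c))) {0..1}"
      using has_integral_affinity[of "\<lambda>x. f (Complex x c)" _ a b "b - a" a] \<open>a < b\<close> by simp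
    then show ?thesis
      by (simp add: integral_unique scaleR_conv_of_real divide_inverse mult.commute)
  qed
  finally have "contour_integral (linepath (Complex a c) (Complex b c)) f
      = integral {a..b} (\<lambda>x. f (Complex x c))" using \<open>a < b\<close> by simp
  then show ?thesis
    by (simp add: integral_norm_bound_integral integrable_continuous_real continuous_on_norm cont)
qed

lemma norm_contour_integral_vertical_le:
  assumes "a < b" and cont: "continuous_on {a..b} (\<lambda>x. f (Complex c x))"
  shows "cmod (contour_integral (linepath (Complex c a) (Complex c b)) f)
           \<le> integral {a..b} (\<lambda>x. cmod (f (Complex c x)))"
  by (subst contour_integral_linepath_same_Re[of _ c _ a b])
    (use assms in \<open>auto simp: norm_mult integral_norm_bound_integral integrable_continuous_real
      continuous_on_norm\<close>)

text \<open>Cauchy's formula for \<open>H w / w\<close> on the boundary of the square of half-side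
  \<open>u\<close> about 0, where \<open>cmod w \<ge> u\<close>.\<close>

lemma norm_le_square_boundary_integral:
  assumes H: "H holomorphic_on UNIV" and u: "u > 0"
  shows "2 * pi * u * cmod (H 0) \<le>
      integral {-u..u} (\<lambda>y. cmod (H (Complex u y))) + integral {-u..u} (\<lambda>y. cmod (H (Complex (-u) y)))
    + integral {-u..u} (\<lambda>x. cmod (H (Complex x u))) + integral {-u..u} (\<lambda>x. cmod (H (Complex x (-u))))"
proof -
  define F where "F w = H w / w" for w
  \<comment> \<open>The corners are \<open>p a b\<close> with \<open>a\<close> and \<open>b\<close>
    equal to 1 or -1, so one estimate with a sign parameter \<open>a\<close> serves two opposite
    sides.\<close>
  define p where "p a b = Complex (a * u) (b * u)" for a b
  define \<gamma> where "\<gamma> = rectpath (p (-1) (-1)) (p 1 1)"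
  have contH: "continuous_on UNIV H" using H by (rule holomorphic_on_imp_continuous_on)
  have contF: "continuous_on A F" if "0 \<notin> A" for A
    unfolding F_def using that
    by (intro continuous_intros continuous_on_subset[OF contH]) auto
  have C: "(F has_contour_integral (2 * pi * \<i> * winding_number \<gamma> 0 * H 0)) \<gamma>"
  proof -
    have "((\<lambda>w. H w / (w - 0)) has_contour_integral (2 * pi * \<i> * winding_number \<gamma> 0 * H 0)) \<gamma>"
    proof (rule Cauchy_integral_formula_convex_simple[OF convex_UNIV H])
      show "path_image \<gamma> \<subseteq> UNIV - {0}"
        unfolding \<gamma>_def using u by (subst path_image_rectpath) (auto simp: p_def)
    qed (auto simp: \<gamma>_def)
    then show ?thesis by (simp add: F_def[abs_def])
  qed
  have "winding_number \<gamma> 0 = 1" unfolding \<gamma>_def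
    by (rule winding_number_rectpath) (use u in \<open>auto simp: in_box_complex_iff p_def\<close>)
  with C have I: "(F has_contour_integral (2 * pi * \<i> * H 0)) \<gamma>" by simp
  have seg: "0 \<notin> closed_segment (p (-1) (-1)) (p 1 (-1))" "0 \<notin> closed_segment (p 1 (-1)) (p 1 1)"
     "0 \<notin> closed_segment (p 1 1) (p (-1) 1)" "0 \<notin> closed_segment (p (-1) 1) (p (-1) (-1))"
    using u by (auto simp: p_def closed_segment_same_Re closed_segment_same_Im)
  note int = contour_integrable_continuous_linepath[OF contF[OF seg(1)]]
    contour_integrable_continuous_linepath[OF contF[OF seg(2)]]
    contour_integrable_continuous_linepath[OF contF[OF seg(3)]]
    contour_integrable_continuous_linepath[OF contF[OF seg(4)]]
  have "\<gamma> = linepath (p (-1) (-1)) (p 1 (-1)) +++ linepath (p 1 (-1)) (p 1 1) +++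
        linepath (p 1 1) (p (-1) 1) +++ linepath (p (-1) 1) (p (-1) (-1))"
    by (simp add: \<gamma>_def rectpath_def p_def Let_def)
  then have "contour_integral \<gamma> F =
      contour_integral (linepath (p (-1) (-1)) (p 1 (-1))) F + contour_integral (linepath (p 1 (-1)) (p 1 1)) F +
      contour_integral (linepath (p 1 1) (p (-1) 1)) F + contour_integral (linepath (p (-1) 1) (p (-1) (-1))) F"
    using int by (simp add: contour_integrable_joinI valid_path_join)
  also have "contour_integral (linepath (p 1 1) (p (-1) 1)) F = - contour_integral (linepath (p (-1) 1) (p 1 1)) F"
    by (rule contour_integral_reverse_linepath[OF contF[OF seg(3)]])
  also have "contour_integral (linepath (p (-1) 1) (p (-1) (-1))) F
      = - contour_integral (linepath (p (-1) (-1)) (p (-1) 1)) F"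
    by (rule contour_integral_reverse_linepath[OF contF[OF seg(4)]])
  finally have eq: "contour_integral \<gamma> F =
      contour_integral (linepath (p (-1) (-1)) (p 1 (-1))) F + contour_integral (linepath (p 1 (-1)) (p 1 1)) F +
      - contour_integral (linepath (p (-1) 1) (p 1 1)) F + - contour_integral (linepath (p (-1) (-1)) (p (-1) 1)) F" .
  have tri: "cmod (a + b + - c + - d) \<le> cmod b + cmod d + cmod c + cmod a" for a b c d
    by (smt (verit) norm_triangle_ineq norm_minus_cancel)
  have "cmod (contour_integral \<gamma> F) \<le>
      cmod (contour_integral (linepath (p 1 (-1)) (p 1 1)) F)
      + cmod (contour_integral (linepath (p (-1) (-1)) (p (-1) 1)) F)
      + cmod (contour_integral (linepath (p (-1) 1) (p 1 1)) F)
      + cmod (contour_integral (linepath (p (-1) (-1)) (p 1 (-1))) F)"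
    unfolding eq by (rule tri)
  moreover have "cmod (contour_integral \<gamma> F) = 2 * pi * cmod (H 0)"
    using contour_integral_unique[OF I] by (simp add: norm_mult)
  moreover have vert: "cmod (contour_integral (linepath (p a (-1)) (p a 1)) F)
      \<le> integral {-u..u} (\<lambda>y. cmod (H (Complex (a * u) y))) / u" if a: "\<bar>a\<bar> = 1" for a
  proof -
    have ne: "Complex (a * u) y \<noteq> 0" for y using a u by (auto simp: complex_eq_iff)
    have cH: "continuous_on {-u..u} (\<lambda>y. H (Complex (a * u) y))"
      by (rule continuous_on_compose2[OF contH]) (auto intro!: continuous_intros)
    have cF: "continuous_on {-u..u} (\<lambda>y. F (Complex (a * u) y))"
      unfolding F_def using ne by (intro continuous_intros cH) auto
    have "cmod (contour_integral (linepath (p a (-1)) (p a 1)) F)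
        \<le> integral {-u..u} (\<lambda>y. cmod (F (Complex (a * u) y)))"
      using norm_contour_integral_vertical_le[OF _ cF] u by (simp add: p_def)
    also have "\<dots> \<le> integral {-u..u} (\<lambda>y. cmod (H (Complex (a * u) y)) / u)"
    proof (rule integral_le)
      fix y
      have "u \<le> cmod (Complex (a * u) y)"
        using abs_Re_le_cmod[of "Complex (a * u) y"] a u by (simp add: abs_mult)
      then show "cmod (F (Complex (a * u) y)) \<le> cmod (H (Complex (a * u) y)) / u"
        unfolding F_def norm_divide using u by (intro divide_left_mono mult_pos_pos) auto
    qed (intro integrable_continuous_real continuous_intros cH cF; use u in simp)+
    finally show ?thesis by simp
  qed
  moreover have hor: "cmod (contour_integral (linepath (p (-1) a) (p 1 a)) F)
      \<le> integral {-u..u} (\<lambda>x. cmod (H (Complex x (a * u)))) / u" if a: "\<bar>a\<bar> = 1" for a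
  proof -
    have ne: "Complex x (a * u) \<noteq> 0" for x using a u by (auto simp: complex_eq_iff)
    have cH: "continuous_on {-u..u} (\<lambda>x. H (Complex x (a * u)))"
      by (rule continuous_on_compose2[OF contH]) (auto intro!: continuous_intros)
    have cF: "continuous_on {-u..u} (\<lambda>x. F (Complex x (a * u)))"
      unfolding F_def using ne by (intro continuous_intros cH) auto
    have "cmod (contour_integral (linepath (p (-1) a) (p 1 a)) F)
        \<le> integral {-u..u} (\<lambda>x. cmod (F (Complex x (a * u))))"
      using norm_contour_integral_horizontal_le[OF _ cF] u by (simp add: p_def)
    also have "\<dots> \<le> integral {-u..u} (\<lambda>x. cmod (H (Complex x (a * u))) / u)"
    proof (rule integral_le)
      fix x
      have "u \<le> cmod (Complex x (a * u))"
        using abs_Im_le_cmod[of "Complex x (a * u)"] a u by (simp add: abs_mult)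
      then show "cmod (F (Complex x (a * u))) \<le> cmod (H (Complex x (a * u))) / u"
        unfolding F_def norm_divide using u by (intro divide_left_mono mult_pos_pos) auto
    qed (intro integrable_continuous_real continuous_intros cH cF; use u in simp)+
    finally show ?thesis by simp
  qed
  ultimately have "2 * pi * cmod (H 0) \<le>
    (integral {-u..u} (\<lambda>y. cmod (H (Complex u y))) + integral {-u..u} (\<lambda>y. cmod (H (Complex (-u) y)))
    + integral {-u..u} (\<lambda>x. cmod (H (Complex x u))) + integral {-u..u} (\<lambda>x. cmod (H (Complex x (-u))))) / u"
    using vert[of 1] vert[of "-1"] hor[of 1] hor[of "-1"] by (simp add: add_divide_distrib)
  then show ?thesis using u by (simp add: pos_le_divide_eq mult_ac)
qed

lemma integral_outer_part_le:
  fixes V :: "real \<Rightarrow> real"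
  assumes cont: "continuous_on UNIV V" and nn: "\<And>x. V x \<ge> 0" and "R > 0"
  shows "integral {R/2..R} V \<le> integral {-R..R} V"
    and "integral {R/2..R} (\<lambda>u. V (- u)) \<le> integral {-R..R} V"
proof -
  have int: "W integrable_on {a..b}" if "continuous_on UNIV W" for W :: "real \<Rightarrow> real" and a b
    using that by (intro integrable_continuous_real continuous_on_subset[OF that]) auto
  have 1: "integral {R/2..R} V \<le> integral {-R..R} V" if "continuous_on UNIV V" "\<And>x. V x \<ge> 0"
    for V :: "real \<Rightarrow> real"
    using that assms(3) by (intro integral_subset_le int) auto
  from 1[OF cont nn] show "integral {R/2..R} V \<le> integral {-R..R} V" .
  have "continuous_on UNIV (\<lambda>u. V (- u))"
    by (rule continuous_on_compose2[OF cont]) (auto intro!: continuous_intros)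
  from 1[OF this nn] show "integral {R/2..R} (\<lambda>u. V (- u)) \<le> integral {-R..R} V"
    using Henstock_Kurzweil_Integration.integral_reflect_real[of R "-R" V] by simp
qed

text \<open>Averaging Cauchy's formula over squares of half-side between \<open>R/2\<close> and \<open>R\<close> replaces polar
  coordinates.\<close>

lemma norm_le_square_mean:
  assumes H: "H holomorphic_on UNIV" and R: "R > 0"
  shows "pi * R\<^sup>2 * cmod (H 0) \<le>
    8 * integral {-R..R} (\<lambda>x. integral {-R..R} (\<lambda>y. cmod (H (Complex x y))))"
proof -
  define V where "V x = integral {-R..R} (\<lambda>y. cmod (H (Complex x y)))" for x
  define W where "W y = integral {-R..R} (\<lambda>x. cmod (H (Complex x y)))" for y
  have contH: "continuous_on UNIV H" using H by (rule holomorphic_on_imp_continuous_on)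
  have contH2: "continuous_on A (\<lambda>z. cmod (H (Complex (g z) (h z))))"
    if "continuous_on A g" "continuous_on A h" for A :: "'a::topological_space set" and g h
    by (intro continuous_on_norm continuous_on_compose2[OF contH] that continuous_intros) auto
  have int: "W integrable_on {a..b}" if "continuous_on UNIV W" for W :: "real \<Rightarrow> real" and a b
    using that by (intro integrable_continuous_real continuous_on_subset[OF that]) auto
  have "continuous_on (UNIV \<times> cbox (-R) R) (\<lambda>(x, y). cmod (H (Complex x y)))"
    "continuous_on (UNIV \<times> cbox (-R) R) (\<lambda>(y, x). cmod (H (Complex x y)))"
    unfolding case_prod_unfold by (intro contH2 continuous_intros)+
  from this[THEN integral_continuous_on_param]
  have contV: "continuous_on UNIV V" and contW: "continuous_on UNIV W"
    by (simp_all add: V_def[abs_def] W_def[abs_def])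
  have nn: "V x \<ge> 0" "W x \<ge> 0" for x
    unfolding V_def W_def
    by (intro integral_nonneg integrable_continuous_real contH2 continuous_intros; simp)+
  have VW: "integral {-R..R} V = integral {-R..R} W"
    using integral_swap_continuous[of "-R" "-R" R R "\<lambda>x y. cmod (H (Complex x y))"]
    unfolding V_def W_def by (simp add: case_prod_unfold contH2 continuous_intros)
  have contm: "continuous_on UNIV (\<lambda>u. V (- u))" "continuous_on UNIV (\<lambda>u. W (- u))"
    by (rule continuous_on_compose2[OF contV] continuous_on_compose2[OF contW];
        auto intro!: continuous_intros)+
  \<comment> \<open>Since \<open>R \<le> 2 * u\<close>, the left-hand side can be made independent
    of \<open>u\<close>; on the right, the sides are lengthened to \<open>{-R..R}\<close>, so that
    averaging over \<open>u\<close> yields double integrals over the full square.\<close>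
  have *: "pi * R * cmod (H 0) \<le> V u + V (- u) + W u + W (- u)" if u: "u \<in> {R/2..R}" for u
  proof -
    have u': "u > 0" "u \<le> R" "R \<le> 2 * u" using u R by auto
    have sub: "integral {-u..u} g \<le> integral {-R..R} g"
      if "continuous_on UNIV g" "\<And>x. g x \<ge> 0" for g :: "real \<Rightarrow> real"
      using that u' by (intro integral_subset_le int) auto
    have "pi * R * cmod (H 0) \<le> pi * (2 * u) * cmod (H 0)"
      using u' by (intro mult_right_mono mult_left_mono) auto
    also have "\<dots> = 2 * pi * u * cmod (H 0)" by simp
    also note norm_le_square_boundary_integral[OF H u'(1)]
    also have "integral {-u..u} (\<lambda>y. cmod (H (Complex u y))) + integral {-u..u} (\<lambda>y. cmod (H (Complex (-u) y)))
    + integral {-u..u} (\<lambda>x. cmod (H (Complex x u))) + integral {-u..u} (\<lambda>x. cmod (H (Complex x (-u))))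
      \<le> V u + V (- u) + W u + W (- u)"
      unfolding V_def W_def by (intro add_mono sub contH2 continuous_intros) auto
    finally show ?thesis .
  qed
  have "integral {R/2..R} (\<lambda>u. pi * R * cmod (H 0))
      \<le> integral {R/2..R} (\<lambda>u. V u + V (- u) + W u + W (- u))"
    by (rule integral_le) (use * contm contV contW in \<open>auto intro!: int continuous_intros\<close>)
  also have "\<dots> = integral {R/2..R} V + integral {R/2..R} (\<lambda>u. V (- u)) + integral {R/2..R} W
      + integral {R/2..R} (\<lambda>u. W (- u))"
    using contm contV contW by (simp add: integral_add int integrable_add)
  \<comment> \<open>Each of the four sides sweeps out at most the full double integral. The interval
    of averaging has length \<open>R / 2\<close>, which doubles the resulting 4 to the constant
    8.\<close>
  also have "\<dots> \<le> integral {-R..R} V + integral {-R..R} V + integral {-R..R} W + integral {-R..R} W"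
    by (intro add_mono integral_outer_part_le contV contW nn R)
  also have "\<dots> = 4 * integral {-R..R} V" by (simp add: VW)
  also have "integral {R/2..R} (\<lambda>u. pi * R * cmod (H 0)) = pi * R\<^sup>2 * cmod (H 0) / 2"
    using R by (simp add: power2_eq_square field_simps)
  finally show ?thesis by (simp add: V_def)
qed

section \<open>The Bloch and BMOA norms\<close>

lemma bloch_norm_le_iff:
  "B \<ge> 0 \<Longrightarrow> bloch_norm f \<le> ennreal B \<longleftrightarrow> (\<forall>\<sigma>>0. \<forall>t. \<sigma> * cmod (deriv f (Complex \<sigma> t)) \<le> B)"
  by (auto simp: bloch_norm_def SUP_le_iff ennreal_le_iff)

lemma bloch_normD:
  assumes "bloch_norm f \<le> ennreal B" "B \<ge> 0" "\<sigma> > 0"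
  shows "cmod (deriv f (Complex \<sigma> t)) \<le> B / \<sigma>"
  using assms by (simp add: bloch_norm_le_iff pos_le_divide_eq mult.commute)

lemma sup_norm_le_iff:
  "B \<ge> 0 \<Longrightarrow> sup_norm f \<le> ennreal B \<longleftrightarrow> (\<forall>s. Re s > 0 \<longrightarrow> cmod (f s) \<le> B)"
  by (auto simp: sup_norm_def SUP_le_iff ennreal_le_iff)

section \<open>Carleson square integrals as real integrals\<close>

lemma nn_integral_continuous_Icc:
  fixes g :: "real \<Rightarrow> real"
  assumes "continuous_on {a..b} g" "\<And>x. x \<in> {a..b} \<Longrightarrow> g x \<ge> 0"
  shows "(\<integral>\<^sup>+x\<in>{a..b}. ennreal (g x) \<partial>lborel) = ennreal (integral {a..b} g)"
proof -
  have "(g has_integral integral {a..b} g) {a..b}"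
    using integrable_continuous_real[OF assms(1)] by (rule integrable_integral)
  from nn_integral_has_integral_lebesgue[OF assms(2) this]
  show ?thesis
    by (simp add: nn_integral_set_ennreal mult.commute)
qed

text \<open>The integral of \<open>\<bar>g\<bar>^2 * \<sigma>\<close> over the Carleson square of
  side \<open>h\<close> resting on \<open>{t..t+h}\<close>. It is real-valued so that primitives and
  integral comparisons can be used directly; for continuous \<open>g\<close> it agrees with the
  integral in the BMOA norm.\<close>

definition carleson :: "(complex \<Rightarrow> complex) \<Rightarrow> real \<Rightarrow> real \<Rightarrow> real" where
  "carleson g h t = integral {0..h} (\<lambda>\<sigma>. integral {t..t+h} (\<lambda>\<tau>. (cmod (g (Complex \<sigma> \<tau>)))\<^sup>2 * \<sigma>))"

context
  fixes g :: "complex \<Rightarrow> complex"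
  assumes cont_g: "continuous_on UNIV g"
begin

lemma continuous_carleson_integrand:
  "continuous_on A p \<Longrightarrow> continuous_on A q \<Longrightarrow> continuous_on A r \<Longrightarrow>
    continuous_on A (\<lambda>z. (cmod (g (Complex (p z) (q z))))\<^sup>2 * r z)"
  by (intro continuous_intros continuous_on_compose2[OF cont_g]) auto

lemma continuous_carleson_inner:
  "continuous_on A (\<lambda>\<sigma>. integral {a..b} (\<lambda>\<tau>. (cmod (g (Complex \<sigma> \<tau>)))\<^sup>2 * \<sigma>))"
proof -
  have "continuous_on (A \<times> cbox a b) (\<lambda>(\<sigma>, \<tau>). (cmod (g (Complex \<sigma> \<tau>)))\<^sup>2 * \<sigma>)"
    unfolding case_prod_unfold by (intro continuous_carleson_integrand continuous_intros)
  from integral_continuous_on_param[OF this] show ?thesis by simp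
qed

lemma carleson_inner_nonneg:
  "\<sigma> \<ge> 0 \<Longrightarrow> integral {a..b} (\<lambda>\<tau>. (cmod (g (Complex \<sigma> \<tau>)))\<^sup>2 * \<sigma>) \<ge> 0"
  by (intro integral_nonneg integrable_continuous_real continuous_carleson_integrand continuous_intros) auto

lemma carleson_nonneg: "carleson g h t \<ge> 0"
  unfolding carleson_def
  by (intro integral_nonneg integrable_continuous_real continuous_carleson_inner carleson_inner_nonneg) auto

lemma nn_integral_carleson:
  "(\<integral>\<^sup>+\<sigma>\<in>{0..h}. (\<integral>\<^sup>+\<tau>\<in>{t..t+h}. ennreal ((cmod (g (Complex \<sigma> \<tau>)))\<^sup>2 * \<sigma>) \<partial>lborel) \<partial>lborel)
    = ennreal (carleson g h t)"
proof -
  have "(\<integral>\<^sup>+\<tau>\<in>{t..t+h}. ennreal ((cmod (g (Complex \<sigma> \<tau>)))\<^sup>2 * \<sigma>) \<partial>lborel)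
      = ennreal (integral {t..t+h} (\<lambda>\<tau>. (cmod (g (Complex \<sigma> \<tau>)))\<^sup>2 * \<sigma>))" if "\<sigma> \<in> {0..h}" for \<sigma>
    using that by (intro nn_integral_continuous_Icc continuous_carleson_integrand continuous_intros) auto
  then have "(\<integral>\<^sup>+\<sigma>\<in>{0..h}. (\<integral>\<^sup>+\<tau>\<in>{t..t+h}. ennreal ((cmod (g (Complex \<sigma> \<tau>)))\<^sup>2 * \<sigma>) \<partial>lborel) \<partial>lborel)
      = (\<integral>\<^sup>+\<sigma>\<in>{0..h}. ennreal (integral {t..t+h} (\<lambda>\<tau>. (cmod (g (Complex \<sigma> \<tau>)))\<^sup>2 * \<sigma>)) \<partial>lborel)"
    by (intro nn_integral_cong) (simp split: split_indicator)
  also have "\<dots> = ennreal (carleson g h t)"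
    unfolding carleson_def
    by (intro nn_integral_continuous_Icc continuous_carleson_inner carleson_inner_nonneg) auto
  finally show ?thesis .
qed

end

lemma bmoa_norm_sq_eq:
  assumes "continuous_on UNIV (deriv f)"
  shows "bmoa_norm_sq f = (SUP h\<in>{0<..}. SUP t. ennreal (carleson (deriv f) h t / h))"
  unfolding bmoa_norm_sq_def nn_integral_carleson[OF assms]
proof (intro SUP_cong refl)
  fix h :: real assume "h \<in> {0<..}"
  then show "ennreal (1 / h) * (SUP t. ennreal (carleson (deriv f) h t))
      = (SUP t. ennreal (carleson (deriv f) h t / h))"
    by (simp add: SUP_mult_left_ennreal ennreal_mult'[symmetric])
qed

section \<open>The BMOA norm and its comparison with the Bloch norm\<close>

lemma ennreal_sqrt_mono: "x \<le> y \<Longrightarrow> ennreal_sqrt x \<le> ennreal_sqrt y"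
  unfolding ennreal_sqrt_def
  by (auto simp: top_unique less_top intro!: ennreal_leI enn2real_mono)

lemma ennreal_sqrt_ennreal: "x \<ge> 0 \<Longrightarrow> ennreal_sqrt (ennreal x) = ennreal (sqrt x)"
  by (simp add: ennreal_sqrt_def)

lemma bmoa_norm_leI:
  assumes "continuous_on UNIV (deriv f)" "B \<ge> 0"
    and "\<And>h t. h > 0 \<Longrightarrow> carleson (deriv f) h t \<le> B\<^sup>2 * h"
  shows "bmoa_norm f \<le> ennreal B"
proof -
  have "bmoa_norm_sq f \<le> ennreal (B\<^sup>2)"
    unfolding bmoa_norm_sq_eq[OF assms(1)]
    using assms by (intro SUP_least ennreal_leI) (auto simp: pos_divide_le_eq)
  from ennreal_sqrt_mono[OF this] show ?thesis
    using assms by (simp add: bmoa_norm_def ennreal_sqrt_ennreal)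
qed

lemma bmoa_norm_geI:
  assumes "continuous_on UNIV (deriv f)" "h > 0" "B\<^sup>2 * h \<le> carleson (deriv f) h t" "B \<ge> 0"
  shows "ennreal B \<le> bmoa_norm f"
proof -
  have "ennreal (B\<^sup>2) \<le> ennreal (carleson (deriv f) h t / h)"
    using assms by (intro ennreal_leI) (simp add: pos_le_divide_eq)
  also have "\<dots> \<le> bmoa_norm_sq f"
    unfolding bmoa_norm_sq_eq[OF assms(1)] using assms(2) by (intro SUP_upper2[of h] SUP_upper) auto
  finally have "ennreal (B\<^sup>2) \<le> bmoa_norm_sq f" .
  from ennreal_sqrt_mono[OF this] show ?thesis
    using assms by (simp add: bmoa_norm_def ennreal_sqrt_ennreal)
qed

lemma carleson_le_bmoa_norm:
  assumes "continuous_on UNIV (deriv f)" "h > 0" "bmoa_norm f \<le> ennreal B" "B \<ge> 0"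
  shows "carleson (deriv f) h t \<le> B\<^sup>2 * h"
proof -
  let ?C = "carleson (deriv f) h t"
  have nn: "?C / h \<ge> 0" using carleson_nonneg[OF assms(1)] assms(2) by simp
  have "ennreal (sqrt (?C / h)) \<le> bmoa_norm f"
    by (rule bmoa_norm_geI[OF assms(1,2)]) (use nn assms(2) in auto)
  with assms(3,4) have "sqrt (?C / h) \<le> B" by (metis order_trans ennreal_le_iff)
  then have "?C / h \<le> B\<^sup>2" using assms(4) nn by (metis real_sqrt_le_iff real_sqrt_unique)
  then show ?thesis using assms(2) by (simp add: pos_divide_le_eq)
qed

text \<open>The area mean value inequality for the square of \<open>deriv f\<close> bounds its value
  at a point by its integral over a square about that point. Keeping this square away from the
  imaginary axis bounds the weight from below, so a Carleson square controls the integral.\<close>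

lemma bloch_norm_le_bmoa_norm:
  assumes hol: "deriv f holomorphic_on UNIV"
  shows "bloch_norm f \<le> ennreal 6 * bmoa_norm f"
proof (cases "bmoa_norm f = \<infinity>")
  case True
  then show ?thesis by (simp add: ennreal_mult_top)
next
  case False
  then obtain B where B: "bmoa_norm f = ennreal B" "B \<ge> 0" by (cases "bmoa_norm f") auto
  define g where "g = deriv f"
  have cont: "continuous_on UNIV g"
    using hol unfolding g_def by (rule holomorphic_on_imp_continuous_on)
  have main: "\<sigma> * cmod (g (Complex \<sigma> t)) \<le> 6 * B" if \<sigma>: "\<sigma> > 0" for \<sigma> t
  proof -
    \<comment> \<open>With this half-side the abscissas run over \<open>{R..3*R}\<close>: the weight
      is at least \<open>R\<close>, and the square lies in the Carleson square of side
      \<open>3 * R\<close> with base starting at \<open>t - R\<close>.\<close>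
    define R where "R = \<sigma> / 2"
    have R: "R > 0" "\<sigma> = 2 * R" using \<sigma> by (auto simp: R_def)
    define H where "H w = (g (Complex \<sigma> t + w))\<^sup>2" for w
    have H: "H holomorphic_on UNIV"
      unfolding H_def
      by (intro holomorphic_intros holomorphic_on_compose_gen[OF _ hol[folded g_def], unfolded o_def]) auto
    define \<phi> where "\<phi> x y = (cmod (g (Complex x y)))\<^sup>2" for x y
    have cont_\<phi>: "continuous_on A (\<lambda>z. \<phi> (p z) (q z))" if "continuous_on A p" "continuous_on A q"
      for A :: "'a::topological_space set" and p q
      unfolding \<phi>_def using that by (intro continuous_intros continuous_on_compose2[OF cont]) auto
    have nn: "\<phi> x y \<ge> 0" for x y by (simp add: \<phi>_def)
    have *: "cmod (H (Complex x y)) = \<phi> (x + \<sigma>) (y + t)" for x y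
      by (simp add: H_def \<phi>_def norm_power add.commute complex_eq_iff
          arg_cong[of "Complex \<sigma> t + Complex x y" "Complex (x + \<sigma>) (y + t)"])
    have "integral {-R..R} (\<lambda>x. integral {-R..R} (\<lambda>y. cmod (H (Complex x y))))
        = integral {\<sigma>-R..\<sigma>+R} (\<lambda>x. integral {t-R..t+R} (\<lambda>y. \<phi> x y))"
      unfolding *
      using integral_shift_real_ivl[of "\<sigma>-R" \<sigma> "\<sigma>+R" "\<lambda>x. integral {t-R..t+R} (\<lambda>y. \<phi> x y)"]
        integral_shift_real_ivl[of "t-R" t "t+R" "\<phi> (x + \<sigma>)" for x] by simp
    also have "R * \<dots> \<le> carleson g (3 * R) (t - R)"
    proof -
      have "R * integral {\<sigma>-R..\<sigma>+R} (\<lambda>x. integral {t-R..t+R} (\<lambda>y. \<phi> x y))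
          = integral {\<sigma>-R..\<sigma>+R} (\<lambda>x. integral {t-R..t+R} (\<lambda>y. R * \<phi> x y))"
        by simp
      also have "\<dots> \<le> integral {\<sigma>-R..\<sigma>+R} (\<lambda>x. integral {t-R..t-R+3*R} (\<lambda>y. \<phi> x y * x))"
      proof (intro integral_le)
        fix x assume x: "x \<in> {\<sigma> - R..\<sigma> + R}"
        then have x: "x \<ge> R" using R by auto
        have "integral {t-R..t+R} (\<lambda>y. R * \<phi> x y) \<le> integral {t-R..t+R} (\<lambda>y. \<phi> x y * x)"
          using x nn by (intro integral_le integrable_continuous_real continuous_intros cont_\<phi>)
            (auto simp: mult.commute intro!: mult_right_mono)
        also have "\<dots> \<le> integral {t-R..t-R+3*R} (\<lambda>y. \<phi> x y * x)"
          using x nn R by (intro integral_subset_le integrable_continuous_real continuous_intros cont_\<phi>) auto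
        finally show "integral {t-R..t+R} (\<lambda>y. R * \<phi> x y) \<le> integral {t-R..t-R+3*R} (\<lambda>y. \<phi> x y * x)" .
      next
        have "continuous_on ({\<sigma>-R..\<sigma>+R} \<times> cbox (t-R) (t+R)) (\<lambda>(x, y). R * \<phi> x y)"
          unfolding case_prod_unfold by (intro continuous_intros cont_\<phi>)
        from integral_continuous_on_param[OF this]
        show "(\<lambda>x. integral {t-R..t+R} (\<lambda>y. R * \<phi> x y)) integrable_on {\<sigma>-R..\<sigma>+R}"
          by (intro integrable_continuous_real) simp
        show "(\<lambda>x. integral {t-R..t-R+3*R} (\<lambda>y. \<phi> x y * x)) integrable_on {\<sigma>-R..\<sigma>+R}"
          unfolding \<phi>_def by (intro integrable_continuous_real continuous_carleson_inner cont)
      qed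
      also have "\<dots> \<le> carleson g (3 * R) (t - R)"
        unfolding carleson_def \<phi>_def
      proof (intro integral_subset_le integrable_continuous_real continuous_carleson_inner cont ballI)
        show "0 \<le> integral {t-R..t-R+3*R} (\<lambda>y. (cmod (g (Complex x y)))\<^sup>2 * x)" if "x \<in> {0..3*R}" for x
          using that by (intro carleson_inner_nonneg cont) auto
      qed (use R in auto)
      finally show ?thesis .
    qed
    also have "\<dots> \<le> B\<^sup>2 * (3 * R)"
      using carleson_le_bmoa_norm[of f "3 * R" B "t - R"] cont B R unfolding g_def by simp
    finally have I: "integral {-R..R} (\<lambda>x. integral {-R..R} (\<lambda>y. cmod (H (Complex x y)))) \<le> 3 * B\<^sup>2"
      using R by (simp add: mult.commute)
    have H0: "cmod (H 0) = (cmod (g (Complex \<sigma> t)))\<^sup>2" by (simp add: H_def norm_power)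
    \<comment> \<open>The estimate \<open>pi \<ge> 3\<close> cancels the 3 in \<open>I\<close>,
      leaving \<open>8 * B^2\<close>. This is at most \<open>(3 * B)^2\<close>, and
      \<open>\<sigma> = 2 * R\<close> turns the 3 into 6.\<close>
    have "3 * (R * cmod (g (Complex \<sigma> t)))\<^sup>2 = 3 * R\<^sup>2 * cmod (H 0)"
      by (simp add: H0 power_mult_distrib)
    also have "\<dots> \<le> pi * R\<^sup>2 * cmod (H 0)"
      using pi_gt3 by (intro mult_right_mono) auto
    also note norm_le_square_mean[OF H R(1)]
    also note mult_left_mono[OF I, of 8]
    finally have "(R * cmod (g (Complex \<sigma> t)))\<^sup>2 \<le> 8 * B\<^sup>2" by simp
    also have "\<dots> \<le> (3 * B)\<^sup>2" by (simp add: power_mult_distrib)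
    finally have "R * cmod (g (Complex \<sigma> t)) \<le> 3 * B"
      by (rule power2_le_imp_le) (use B in simp)
    then show ?thesis by (simp add: R)
  qed
  have "bloch_norm f \<le> ennreal (6 * B)"
    using main B by (subst bloch_norm_le_iff) (auto simp: g_def)
  then show ?thesis using B by (simp add: ennreal_mult)
qed

section \<open>Upper bounds in terms of the Bloch norm\<close>

text \<open>The mean value inequality along a horizontal segment, with a real majorant
  \<open>\<phi>'\<close> of the derivative given together with its primitive. This lets each bound
  on the derivative be integrated in closed form.\<close>

lemma norm_diff_horizontal_le:
  assumes f: "\<And>s. (f has_field_derivative g s) (at s)"
    and ab: "a \<le> b"
    and \<phi>: "\<And>x. a \<le> x \<Longrightarrow> x \<le> b \<Longrightarrow> (\<phi> has_real_derivative \<phi>' x) (at x)"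
    and le: "\<And>x. a \<le> x \<Longrightarrow> x \<le> b \<Longrightarrow> cmod (g (Complex x t)) \<le> \<phi>' x"
  shows "cmod (f (Complex b t) - f (Complex a t)) \<le> \<phi> b - \<phi> a"
proof (cases "a = b")
  case False
  have C: "((\<lambda>x. Complex x t) has_vector_derivative 1) (at x)" for x
    unfolding Complex_eq by (auto intro!: derivative_eq_intros)
  have F: "((\<lambda>x. f (Complex x t)) has_vector_derivative g (Complex x t)) (at x)" for x
    using field_vector_diff_chain_at[OF C f] by (simp add: o_def)
  show ?thesis
  proof (rule differentiable_bound_general)
    show "a < b" using ab False by simp
    show "continuous_on {a..b} \<phi>"
      by (intro continuous_at_imp_continuous_on ballI DERIV_isCont[OF \<phi>]) auto
    show "continuous_on {a..b} (\<lambda>x. f (Complex x t))"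
      by (intro continuous_at_imp_continuous_on ballI has_vector_derivative_continuous[OF F])
    show "(\<phi> has_vector_derivative \<phi>' x) (at x)" if "a < x" "x < b" for x
      using \<phi>[of x] that by (simp add: has_real_derivative_iff_has_vector_derivative)
  qed (use F le in auto)
qed simp

text \<open>The common setting of the upper bounds. The assumption \<open>lnN\<close> puts
  \<open>1 / L\<close> below 1, which orders the three ranges of \<open>\<sigma>\<close>, and makes
  \<open>ln L\<close> positive.\<close>

locale bloch_bounded_dirichlet_poly =
  fixes N :: nat and c :: "nat \<Rightarrow> complex" and M :: real
  assumes lnN: "ln (real N) > 1"
    and M: "M \<ge> 0"
    and bloch: "bloch_norm (exp_sum {2..N} c (\<lambda>n. ln (real n))) \<le> ennreal M"
begin

abbreviation "L \<equiv> ln (real N)"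
abbreviation "f \<equiv> exp_sum {2..N} c (\<lambda>n. ln (real n))"

lemma f_deriv: "(f has_field_derivative deriv f s) (at s)"
  unfolding deriv_exp_sum by (rule exp_sum_has_field_derivative)

lemma deriv_bound: "Re s > 0 \<Longrightarrow> cmod (deriv f s) \<le> M / Re s"
  using bloch_normD[OF bloch M, of "Re s" "Im s"] by simp

text \<open>The Bloch bound on the line \<open>Re s = 1\<close> is \<open>M\<close>, and every
  frequency is at least \<open>ln 2\<close>.\<close>

lemma deriv_bound_right:
  assumes "Re s \<ge> 1"
  shows "cmod (deriv f s) \<le> M * exp (- ln 2 * (Re s - 1))"
  unfolding deriv_exp_sum
proof (rule exp_sum_decay_right)
  show "cmod (exp_sum {2..N} (\<lambda>k. - complex_of_real (ln (real k)) * c k) (\<lambda>n. ln (real n)) (Complex 1 t)) \<le> M" for t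
    using deriv_bound[of "Complex 1 t"] by (simp add: deriv_exp_sum)
qed (use assms in auto)

text \<open>The Bloch bound on the line \<open>Re s = 1 / L\<close> is \<open>M * L\<close>. Every
  frequency is at most \<open>L\<close>, so moving left by at most \<open>1 / L\<close> costs at
  most a factor \<open>exp 1 \<le> 3\<close>.\<close>

lemma deriv_bound_left:
  assumes "0 \<le> Re s" "Re s \<le> 1 / L"
  shows "cmod (deriv f s) \<le> 3 * M * L"
proof -
  have "cmod (deriv f s) \<le> (M * L) * exp (L * (1 / L - Re s))"
    unfolding deriv_exp_sum
  proof (rule exp_sum_decay_left)
    show "cmod (exp_sum {2..N} (\<lambda>k. - complex_of_real (ln (real k)) * c k) (\<lambda>n. ln (real n)) (Complex (1 / L) t))
        \<le> M * L" for t
      using deriv_bound[of "Complex (1 / L) t"] lnN by (simp add: deriv_exp_sum)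
  qed (use assms in auto)
  also have "\<dots> \<le> (M * L) * 3"
  proof (rule mult_left_mono)
    have "exp (L * (1 / L - Re s)) \<le> exp 1"
      using assms lnN by (simp add: algebra_simps)
    also have "\<dots> \<le> 3" by (rule exp_le)
    finally show "exp (L * (1 / L - Re s)) \<le> 3" .
  qed (use M lnN in auto)
  finally show ?thesis by (simp add: mult_ac)
qed

text \<open>Integration of \<open>deriv f\<close> along a horizontal line: \<open>{0..1/L}\<close>
  contributes \<open>3 * M\<close>, \<open>{1/L..1}\<close> contributes \<open>M * ln L\<close>, and
  the rest at most \<open>M / ln 2 \<le> 2 * M\<close>. The coefficient 1 of \<open>ln L\<close> is
  what yields asymptotic equivalence and not just the order of magnitude.\<close>

lemma norm_f_imaginary_axis_le: "cmod (f (Complex 0 t)) \<le> M * (ln L + 5)"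
proof -
  have ln2: "ln 2 \<ge> (1/2::real)" using ln2_ge_two_thirds by linarith
  have L1: "1 / L \<le> 1" "1 / L > 0" using lnN by auto
  have 1: "cmod (f (Complex (1 / L) t) - f (Complex 0 t)) \<le> 3 * M * L * (1 / L) - 3 * M * L * 0"
    using L1 by (intro norm_diff_horizontal_le[OF f_deriv, where \<phi>' = "\<lambda>_. 3 * M * L"])
      (auto intro!: derivative_eq_intros deriv_bound_left)
  have 2: "cmod (f (Complex 1 t) - f (Complex (1 / L) t)) \<le> M * ln 1 - M * ln (1 / L)"
  proof (rule norm_diff_horizontal_le[OF f_deriv])
    fix x assume "1 / L \<le> x" "x \<le> 1"
    then have x: "x > 0" using L1 by linarith
    then show "((\<lambda>x. M * ln x) has_real_derivative M / x) (at x)"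
      by (auto intro!: derivative_eq_intros)
    show "cmod (deriv f (Complex x t)) \<le> M / x" using deriv_bound[of "Complex x t"] x by simp
  qed (use L1 in auto)
  \<comment> \<open>\<open>K\<close> bounds \<open>f\<close> on the imaginary axis. Since all
    frequencies are at least \<open>ln 2\<close>, \<open>f (Complex X t)\<close> is then at most
    \<open>K * exp (- ln 2 * X)\<close>, so the far endpoint disappears as \<open>X\<close>
    grows.\<close>
  define K where "K = (\<Sum>n=2..N. cmod (c n))"
  have 3: "cmod (f (Complex 0 t)) \<le> M * (ln L + 5) + K * exp (- ln 2 * X)" if X: "X \<ge> 1" for X
  proof -
    define \<phi> where "\<phi> x = - M / ln 2 * exp (- ln 2 * (x - 1))" for x :: real
    have "cmod (f (Complex X t) - f (Complex 1 t)) \<le> \<phi> X - \<phi> 1"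
    proof (rule norm_diff_horizontal_le[OF f_deriv X])
      fix x :: real assume x: "1 \<le> x" "x \<le> X"
      show "(\<phi> has_real_derivative M * exp (- ln 2 * (x - 1))) (at x)"
        unfolding \<phi>_def by (auto intro!: derivative_eq_intros)
      show "cmod (deriv f (Complex x t)) \<le> M * exp (- ln 2 * (x - 1))"
        using deriv_bound_right[of "Complex x t"] x by simp
    qed
    also have "\<dots> \<le> M / ln 2" using M by (simp add: \<phi>_def)
    also have "\<dots> \<le> M * 2"
      using ln2 M mult_left_mono[of 1 "2 * ln 2" M] by (simp add: pos_divide_le_eq mult_ac)
    finally have "cmod (f (Complex X t) - f (Complex 1 t)) \<le> M * 2" .
    moreover have "cmod (f (Complex X t)) \<le> K * exp (- ln 2 * (Re (Complex X t) - 0))"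
    proof (rule exp_sum_decay_right)
      show "cmod (f (Complex 0 t)) \<le> K" for t
        using norm_exp_sum_le[of "{2..N}" c "\<lambda>n. ln (real n)" "Complex 0 t"] by (simp add: K_def)
    qed (use X in auto)
    moreover have "cmod (f (Complex 0 t)) \<le> cmod (f (Complex X t)) + cmod (f (Complex X t) - f (Complex 1 t))
        + cmod (f (Complex 1 t) - f (Complex (1 / L) t)) + cmod (f (Complex (1 / L) t) - f (Complex 0 t))"
    proof -
      have tri: "cmod z0 \<le> cmod z3 + cmod (z3 - z2) + cmod (z2 - z1) + cmod (z1 - z0)" for z0 z1 z2 z3
        using norm_triangle_ineq2[of z0 z1] norm_triangle_ineq2[of z1 z2] norm_triangle_ineq2[of z2 z3]
        by (simp add: norm_minus_commute)
      show ?thesis by (rule tri)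
    qed
    ultimately show ?thesis using 1 2 lnN by (simp add: ln_div algebra_simps)
  qed
  have "((\<lambda>X. M * (ln L + 5) + K * exp (- ln 2 * X)) \<longlongrightarrow> M * (ln L + 5) + K * 0) at_top"
    by (intro tendsto_intros filterlim_compose[OF exp_at_bot]
        filterlim_tendsto_neg_mult_at_bot[OF tendsto_const _ filterlim_ident]) auto
  then have "((\<lambda>X. M * (ln L + 5) + K * exp (- ln 2 * X)) \<longlongrightarrow> M * (ln L + 5)) at_top" by simp
  then show ?thesis
  proof (rule tendsto_lowerbound)
    show "\<forall>\<^sub>F X in at_top. cmod (f (Complex 0 t)) \<le> M * (ln L + 5) + K * exp (- ln 2 * X)"
      using eventually_ge_at_top[of 1] by eventually_elim (rule 3)
  qed simp
qed

text \<open>All frequencies are nonnegative, so the right decay estimate with rate 0 carries the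
  bound from the imaginary axis to the half-plane.\<close>

lemma sup_norm_f_le: "sup_norm f \<le> ennreal (M * (ln L + 5))"
proof (subst sup_norm_le_iff)
  show "0 \<le> M * (ln L + 5)" using norm_f_imaginary_axis_le[of 0] norm_ge_zero order_trans by blast
  show "\<forall>s. 0 < Re s \<longrightarrow> cmod (f s) \<le> M * (ln L + 5)"
    using exp_sum_decay_right[of "{2..N}" 0 "\<lambda>n. ln (real n)" c 0, OF _ norm_f_imaginary_axis_le]
    by simp
qed

text \<open>One formula for the three ranges: up to constants the derivative is bounded by
  \<open>M * L\<close>, \<open>M / \<sigma>\<close> and \<open>M / \<sigma>^2\<close> respectively.
  Multiplied by \<open>\<sigma>\<close>, the resulting majorant of the square has an elementary
  primitive.\<close>

lemma deriv_bound_uniform: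
  assumes \<sigma>: "\<sigma> \<ge> 0"
  shows "(cmod (deriv f (Complex \<sigma> t)))\<^sup>2 * ((1 + L\<^sup>2 * \<sigma>\<^sup>2) * (1 + \<sigma>\<^sup>2)) \<le> 1024 * M\<^sup>2 * L\<^sup>2"
proof -
  let ?D = "cmod (deriv f (Complex \<sigma> t))"
  have ln2: "ln 2 \<ge> (1/2::real)" using ln2_ge_two_thirds by linarith
  have est: "?D\<^sup>2 * ((1 + L\<^sup>2 * \<sigma>\<^sup>2) * (1 + \<sigma>\<^sup>2)) \<le> 1024 * M\<^sup>2 * L\<^sup>2"
    if "?D \<le> A" "1 + L\<^sup>2 * \<sigma>\<^sup>2 \<le> p" "1 + \<sigma>\<^sup>2 \<le> q" "A\<^sup>2 * (p * q) \<le> 1024 * M\<^sup>2 * L\<^sup>2" for A p q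
  proof -
    have nn: "0 \<le> 1 + L\<^sup>2 * \<sigma>\<^sup>2" "0 \<le> 1 + \<sigma>\<^sup>2" by simp_all
    with that have "0 \<le> p" "0 \<le> q" by linarith+
    with nn have "?D\<^sup>2 * ((1 + L\<^sup>2 * \<sigma>\<^sup>2) * (1 + \<sigma>\<^sup>2)) \<le> A\<^sup>2 * (p * q)"
      using that by (intro mult_mono power_mono mult_nonneg_nonneg) auto
    then show ?thesis using that(4) by linarith
  qed
  consider "\<sigma> \<le> 1 / L" | "1 / L \<le> \<sigma>" "\<sigma> \<le> 1" | "1 \<le> \<sigma>" by linarith
  then show ?thesis
  proof cases
    case 1
    then have s: "L * \<sigma> \<le> 1" using lnN by (simp add: pos_le_divide_eq mult.commute)
    have "\<sigma> \<le> 1" using 1 lnN by (smt (verit) divide_le_eq_1)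
    show ?thesis
    proof (rule est)
      show "?D \<le> 3 * M * L" using deriv_bound_left[of "Complex \<sigma> t"] \<sigma> 1 by simp
      show "1 + L\<^sup>2 * \<sigma>\<^sup>2 \<le> 2"
        using power_mono[OF s, of 2] \<sigma> lnN by (simp add: power_mult_distrib)
      show "1 + \<sigma>\<^sup>2 \<le> 2" using power_mono[OF \<open>\<sigma> \<le> 1\<close> \<sigma>, of 2] by simp
      show "(3 * M * L)\<^sup>2 * (2 * 2) \<le> 1024 * M\<^sup>2 * L\<^sup>2" by (simp add: power_mult_distrib)
    qed
  next
    case 2
    then have s: "1 \<le> L * \<sigma>" using lnN by (simp add: pos_divide_le_eq mult.commute)
    have pos: "\<sigma> > 0" using s lnN by (smt (verit) mult_nonneg_nonpos)
    show ?thesis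
    proof (rule est)
      show "?D \<le> M / \<sigma>" using deriv_bound[of "Complex \<sigma> t"] pos by simp
      show "1 + L\<^sup>2 * \<sigma>\<^sup>2 \<le> 2 * (L\<^sup>2 * \<sigma>\<^sup>2)"
        using power_mono[OF s, of 2] by (simp add: power_mult_distrib mult_ac)
      show "1 + \<sigma>\<^sup>2 \<le> 2" using power_mono[OF \<open>\<sigma> \<le> 1\<close> \<sigma>, of 2] by simp
      show "(M / \<sigma>)\<^sup>2 * (2 * (L\<^sup>2 * \<sigma>\<^sup>2) * 2) \<le> 1024 * M\<^sup>2 * L\<^sup>2"
        using pos by (simp add: power_divide)
    qed
  next
    case 3
    have s: "1 \<le> L * \<sigma>" using lnN 3 mult_mono[of 1 L 1 \<sigma>] by simp
    show ?thesis
    proof (rule est)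
      have "?D \<le> M * exp (- ln 2 * (\<sigma> - 1))" using deriv_bound_right[of "Complex \<sigma> t"] 3 by simp
      also have "exp (- ln 2 * (\<sigma> - 1)) = 2 / exp (ln 2 * \<sigma>)"
        by (simp add: algebra_simps exp_diff exp_minus field_simps)
      \<comment> \<open>Of the exponential decay only \<open>\<sigma>^(-2)\<close> is kept, through
        \<open>exp x \<ge> x^2 / 2\<close> and \<open>ln 2 \<ge> 1 / 2\<close>. The factor 16
        obtained here gives the constant \<open>1024 = 16^2 * 2 * 2\<close>.\<close>
      also have "\<dots> \<le> 2 / (\<sigma>\<^sup>2 / 8)"
      proof (rule divide_left_mono)
        have "\<sigma>\<^sup>2 / 8 = (1/2 * \<sigma>)\<^sup>2 / 2" by (simp add: power2_eq_square)
        also have "\<dots> \<le> (ln 2 * \<sigma>)\<^sup>2 / 2"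
          using ln2 \<sigma> by (intro divide_right_mono power_mono mult_right_mono) auto
        also have "\<dots> \<le> exp (ln 2 * \<sigma>)"
        proof -
          have "0 \<le> ln 2 * \<sigma>" using \<sigma> by simp
          from exp_lower_Taylor_quadratic[OF this] this show ?thesis by linarith
        qed
        finally show "\<sigma>\<^sup>2 / 8 \<le> exp (ln 2 * \<sigma>)" .
      qed (use 3 in auto)
      finally show "?D \<le> M * (16 / \<sigma>\<^sup>2)" using M by (simp add: mult_left_mono)
      show "1 + L\<^sup>2 * \<sigma>\<^sup>2 \<le> 2 * (L\<^sup>2 * \<sigma>\<^sup>2)"
        using power_mono[OF s, of 2] by (simp add: power_mult_distrib mult_ac)
      show "1 + \<sigma>\<^sup>2 \<le> 2 * \<sigma>\<^sup>2" using power_mono[OF 3, of 2] by simp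
      show "(M * (16 / \<sigma>\<^sup>2))\<^sup>2 * (2 * (L\<^sup>2 * \<sigma>\<^sup>2) * (2 * \<sigma>\<^sup>2)) \<le> 1024 * M\<^sup>2 * L\<^sup>2"
        using 3 by (simp add: power_mult_distrib power_divide power2_eq_square)
    qed
  qed
qed

text \<open>The majorant does not depend on \<open>\<tau>\<close>, so the inner integral contributes
  a factor \<open>h\<close>; the integral over \<open>\<sigma>\<close> is evaluated exactly and is
  at most \<open>2 * ln L\<close> for every \<open>h\<close>, up to the constant. Finally
  \<open>2 * 1024 \<le> 46^2\<close>.\<close>

lemma carleson_f_le:
  assumes h: "h > 0" and L2: "L \<ge> 2"
  shows "carleson (deriv f) h t \<le> (46 * M * sqrt (ln L))\<^sup>2 * h"
proof -
  define k where "k = 1024 * M\<^sup>2 * h"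
  define w where "w \<sigma> = k * (L\<^sup>2 * \<sigma> / ((1 + L\<^sup>2 * \<sigma>\<^sup>2) * (1 + \<sigma>\<^sup>2)))" for \<sigma> :: real
  \<comment> \<open>The coefficient of the partial fraction decomposition of \<open>w\<close> into
    the logarithmic derivatives of \<open>1 + L^2 * \<sigma>^2\<close> and
    \<open>1 + \<sigma>^2\<close>; it is at most 1 because \<open>L \<ge> 2\<close>.\<close>
  define a where "a = L\<^sup>2 / (L\<^sup>2 - 1) / 2"
  define W where "W \<sigma> = k * (a * (ln (1 + L\<^sup>2 * \<sigma>\<^sup>2) - ln (1 + \<sigma>\<^sup>2)))" for \<sigma> :: real
  have L4: "L\<^sup>2 \<ge> 4" using power_mono[OF L2, of 2] by simp
  have pos: "1 + L\<^sup>2 * x\<^sup>2 > 0" "1 + x\<^sup>2 > 0" for x :: real by (simp_all add: add_pos_nonneg)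
  have cont: "continuous_on UNIV (deriv f)"
    unfolding deriv_exp_sum by (intro continuous_intros)
  have "carleson (deriv f) h t \<le> integral {0..h} w"
    unfolding carleson_def
  proof (rule integral_le)
    show "w integrable_on {0..h}" unfolding w_def
      using pos by (intro integrable_continuous_real continuous_intros) (metis less_irrefl mult_eq_0_iff)
    fix \<sigma> assume "\<sigma> \<in> {0..h}"
    then have \<sigma>: "\<sigma> \<ge> 0" by simp
    have "integral {t..t+h} (\<lambda>\<tau>. (cmod (deriv f (Complex \<sigma> \<tau>)))\<^sup>2 * \<sigma>)
        \<le> integral {t..t+h} (\<lambda>\<tau>. 1024 * M\<^sup>2 * L\<^sup>2 / ((1 + L\<^sup>2 * \<sigma>\<^sup>2) * (1 + \<sigma>\<^sup>2)) * \<sigma>)"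
    proof (rule integral_le)
      fix \<tau>
      show "(cmod (deriv f (Complex \<sigma> \<tau>)))\<^sup>2 * \<sigma>
          \<le> 1024 * M\<^sup>2 * L\<^sup>2 / ((1 + L\<^sup>2 * \<sigma>\<^sup>2) * (1 + \<sigma>\<^sup>2)) * \<sigma>"
        using deriv_bound_uniform[OF \<sigma>, of \<tau>] pos[of \<sigma>] \<sigma>
        by (intro mult_right_mono) (simp_all add: pos_le_divide_eq)
    qed (intro integrable_continuous_real continuous_carleson_integrand cont continuous_intros)+
    also have "\<dots> = w \<sigma>" using h by (simp add: w_def k_def)
    finally show "integral {t..t+h} (\<lambda>\<tau>. (cmod (deriv f (Complex \<sigma> \<tau>)))\<^sup>2 * \<sigma>) \<le> w \<sigma>" .
  qed (intro integrable_continuous_real continuous_carleson_inner cont)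
  also have "integral {0..h} w = W h - W 0"
  proof (rule integral_unique, rule fundamental_theorem_of_calculus)
    fix x assume "x \<in> {0..h}"
    have "(W has_real_derivative
        k * (a * (L\<^sup>2 * (2 * x) / (1 + L\<^sup>2 * x\<^sup>2) - 2 * x / (1 + x\<^sup>2)))) (at x)"
      unfolding W_def using pos[of x] by (auto intro!: derivative_eq_intros)
    also have "a * (L\<^sup>2 * (2 * x) / (1 + L\<^sup>2 * x\<^sup>2) - 2 * x / (1 + x\<^sup>2))
        = L\<^sup>2 * x / ((1 + L\<^sup>2 * x\<^sup>2) * (1 + x\<^sup>2))"
    proof -
      have "L\<^sup>2 * (2 * x) / (1 + L\<^sup>2 * x\<^sup>2) - 2 * x / (1 + x\<^sup>2)
          = (L\<^sup>2 - 1) * (2 * x) / ((1 + L\<^sup>2 * x\<^sup>2) * (1 + x\<^sup>2))"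
        using pos[of x] by (subst diff_frac_eq) (auto simp: algebra_simps)
      also have "a * \<dots> = a * (L\<^sup>2 - 1) * 2 * x / ((1 + L\<^sup>2 * x\<^sup>2) * (1 + x\<^sup>2))" by simp
      also have "a * (L\<^sup>2 - 1) * 2 = L\<^sup>2" using L4 by (simp add: a_def divide_simps)
      finally show ?thesis .
    qed
    finally show "(W has_vector_derivative w x) (at x within {0..h})"
      unfolding w_def by (simp add: has_real_derivative_iff_has_vector_derivative
          has_vector_derivative_at_within)
  qed (use h in simp)
  also have "\<dots> \<le> k * (1 * (2 * ln L))"
  proof -
    \<comment> \<open>The quotient of \<open>1 + L^2 * h^2\<close> by \<open>1 + h^2\<close> never
      exceeds \<open>L^2\<close>, which makes the bound uniform in \<open>h\<close>.\<close>
    have "ln (1 + L\<^sup>2 * h\<^sup>2) \<le> ln (L\<^sup>2 * (1 + h\<^sup>2))"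
      using pos[of h] L4 by (intro ln_mono) (auto simp: algebra_simps)
    also have "\<dots> = 2 * ln L + ln (1 + h\<^sup>2)"
      using lnN pos[of h] by (simp add: ln_mult ln_realpow)
    finally have d: "ln (1 + L\<^sup>2 * h\<^sup>2) - ln (1 + h\<^sup>2) \<le> 2 * ln L" by simp
    have "1 * h\<^sup>2 \<le> L\<^sup>2 * h\<^sup>2" using L4 by (intro mult_right_mono) auto
    then have "0 \<le> ln (1 + L\<^sup>2 * h\<^sup>2) - ln (1 + h\<^sup>2)" using pos[of h] by simp
    moreover have "a \<le> 1" unfolding a_def using L4 by (simp add: field_simps)
    ultimately have "a * (ln (1 + L\<^sup>2 * h\<^sup>2) - ln (1 + h\<^sup>2)) \<le> 1 * (2 * ln L)"
      using d by (intro mult_mono) auto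
    moreover have "k \<ge> 0" using h by (simp add: k_def)
    ultimately show ?thesis by (simp add: W_def mult_left_mono)
  qed
  also have "\<dots> \<le> (46 * M * sqrt (ln L))\<^sup>2 * h"
    using L2 h M by (simp add: k_def power_mult_distrib)
  finally show ?thesis .
qed

end

section \<open>The upper bounds as inequalities between extended norms\<close>

lemma sup_norm_le_bloch_norm:
  assumes "F \<in> dirichlet_polys N" "ln (real N) > 1"
  shows "sup_norm F \<le> ennreal (ln (ln (real N)) + 5) * bloch_norm F"
proof (cases "bloch_norm F = \<infinity>")
  case True
  \<comment> \<open>In \<open>ennreal\<close> zero times infinity is zero, so the factor must be
    positive for the right-hand side to be infinite.\<close>
  have "ln (ln (real N)) > 0" using assms(2) by simp
  then show ?thesis using True by (simp add: ennreal_mult_top)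
next
  case False
  then obtain M where FM: "bloch_norm F = ennreal M" "M \<ge> 0" by (cases "bloch_norm F") auto
  obtain c where c: "F = exp_sum {2..N} c (\<lambda>n. ln (real n))" using assms(1) by (rule dirichlet_polysE)
  interpret bloch_bounded_dirichlet_poly N c M
    using assms FM c by unfold_locales auto
  have "sup_norm F \<le> ennreal (M * (ln (ln (real N)) + 5))" using sup_norm_f_le c by simp
  also have "\<dots> = ennreal (ln (ln (real N)) + 5) * ennreal M"
    using FM assms by (subst mult.commute, intro ennreal_mult) auto
  finally show ?thesis by (simp only: FM(1))
qed

lemma bmoa_norm_le_bloch_norm:
  assumes "F \<in> dirichlet_polys N" "ln (real N) \<ge> 2"
  shows "bmoa_norm F \<le> ennreal (46 * sqrt (ln (ln (real N)))) * bloch_norm F"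
proof (cases "bloch_norm F = \<infinity>")
  case True
  have "ln (ln (real N)) > 0" using assms(2) by simp
  then show ?thesis using True by (simp add: ennreal_mult_top)
next
  case False
  then obtain M where FM: "bloch_norm F = ennreal M" "M \<ge> 0" by (cases "bloch_norm F") auto
  obtain c where c: "F = exp_sum {2..N} c (\<lambda>n. ln (real n))" using assms(1) by (rule dirichlet_polysE)
  interpret bloch_bounded_dirichlet_poly N c M
    using assms FM c by unfold_locales auto
  have "bmoa_norm F \<le> ennreal (46 * M * sqrt (ln (ln (real N))))"
    unfolding c
  proof (rule bmoa_norm_leI)
    show "continuous_on UNIV (deriv (exp_sum {2..N} c (\<lambda>n. ln (real n))))"
      unfolding deriv_exp_sum by (intro continuous_intros)
  qed (use carleson_f_le assms FM in auto)
  also have "46 * M * sqrt (ln (ln (real N))) = 46 * sqrt (ln (ln (real N))) * M" by simp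
  also have "ennreal \<dots> = ennreal (46 * sqrt (ln (ln (real N)))) * ennreal M"
    using FM assms by (intro ennreal_mult) auto
  finally show ?thesis by (simp only: FM(1))
qed

lemma holomorphic_deriv_dirichlet_poly: "F \<in> dirichlet_polys N \<Longrightarrow> deriv F holomorphic_on UNIV"
  by (auto elim!: dirichlet_polysE simp: deriv_exp_sum holomorphic_on_exp_sum)

section \<open>Extremal polynomials\<close>

lemma has_integral_exp_period:
  fixes a t T :: real
  assumes "a \<noteq> 0" "T \<ge> 0" and per: "exp (\<i> * of_real (a * T)) = 1"
  shows "((\<lambda>\<tau>. exp (\<i> * of_real (a * \<tau>))) has_integral 0) {t..t+T}"
proof -
  define G where "G \<tau> = exp (\<i> * of_real (a * \<tau>)) / (\<i> * of_real a)" for \<tau>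
  have "(G has_vector_derivative exp (\<i> * of_real (a * x))) (at x within {t..t+T})" for x
  proof -
    have "((\<lambda>z. exp (\<i> * of_real a * z) / (\<i> * of_real a)) has_field_derivative
        exp (\<i> * of_real a * of_real x)) (at (of_real x))"
      using assms(1) by (auto intro!: derivative_eq_intros)
    from has_vector_derivative_real_field[OF this] show ?thesis
      by (simp add: G_def[abs_def] mult.assoc has_vector_derivative_at_within)
  qed
  then have "((\<lambda>\<tau>. exp (\<i> * of_real (a * \<tau>))) has_integral (G (t + T) - G t)) {t..t+T}"
    using assms(2) by (intro fundamental_theorem_of_calculus) auto
  also have "exp (\<i> * of_real (a * (t + T))) = exp (\<i> * of_real (a * t)) * exp (\<i> * of_real (a * T))"
    by (simp add: algebra_simps flip: exp_add)
  then have "G (t + T) - G t = 0" using per by (simp add: G_def)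
  finally show ?thesis .
qed

text \<open>In the imaginary direction all terms have period \<open>2 * pi / ln 2\<close>, and
  \<open>T\<close> is a whole number of periods. The off-diagonal products therefore integrate to 0,
  whatever the starting point \<open>t\<close>.\<close>

lemma exp_sum_parseval:
  fixes m :: nat and J :: "nat set"
  assumes J: "finite J" and T: "T = real m * (2 * pi / ln 2)"
  shows "((\<lambda>\<tau>. (cmod (exp_sum J d (\<lambda>j. real j * ln 2) (Complex \<sigma> \<tau>)))\<^sup>2) has_integral
    T * (\<Sum>j\<in>J. (cmod (d j))\<^sup>2 * exp (- (2 * real j * ln 2 * \<sigma>)))) {t..t+T}"
proof -
  define E where "E = exp_sum J d (\<lambda>j. real j * ln 2)"
  define A where "A j k = d j * cnj (d k) * of_real (exp (- ((real j + real k) * ln 2 * \<sigma>)))" for j k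
  have T0: "T \<ge> 0" unfolding T by simp
  have E: "of_real ((cmod (E (Complex \<sigma> \<tau>)))\<^sup>2)
      = (\<Sum>j\<in>J. \<Sum>k\<in>J. A j k * exp (\<i> * of_real ((real k - real j) * ln 2 * \<tau>)))" for \<tau>
  proof -
    have "d j * exp (- (of_real (real j * ln 2) * Complex \<sigma> \<tau>))
        * cnj (d k * exp (- (of_real (real k * ln 2) * Complex \<sigma> \<tau>)))
        = A j k * exp (\<i> * of_real ((real k - real j) * ln 2 * \<tau>))" for j k
    proof -
      have "- (of_real (real j * ln 2) * Complex \<sigma> \<tau>) + cnj (- (of_real (real k * ln 2) * Complex \<sigma> \<tau>))
          = of_real (- ((real j + real k) * ln 2 * \<sigma>)) + \<i> * of_real ((real k - real j) * ln 2 * \<tau>)"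
        by (simp add: complex_eq_iff algebra_simps)
      from arg_cong[OF this, of exp] show ?thesis
        unfolding A_def exp_add exp_cnj[symmetric] exp_of_real by (simp add: mult_ac)
    qed
    then show ?thesis
      unfolding complex_norm_square E_def exp_sum_def cnj_sum sum_product by simp
  qed
  have "((\<lambda>\<tau>. \<Sum>j\<in>J. \<Sum>k\<in>J. A j k * exp (\<i> * of_real ((real k - real j) * ln 2 * \<tau>))) has_integral
      (\<Sum>j\<in>J. \<Sum>k\<in>J. if k = j then of_real T * A j j else 0)) {t..t+T}"
  proof (intro has_integral_sum J)
    fix j k
    show "((\<lambda>\<tau>. A j k * exp (\<i> * of_real ((real k - real j) * ln 2 * \<tau>))) has_integral
        (if k = j then of_real T * A j j else 0)) {t..t+T}"
    proof (cases "k = j")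
      case True
      then show ?thesis
        using has_integral_const_real[of "A j j" t "t + T"] T0 by (simp add: scaleR_conv_of_real)
    next
      case False
      have "exp (\<i> * of_real ((real k - real j) * ln 2 * T))
          = exp (of_real (2 * real_of_int ((int k - int j) * int m) * pi) * \<i>)"
        unfolding T by (intro arg_cong[of _ _ exp]) (simp add: complex_eq_iff algebra_simps)
      also have "\<dots> = 1" by (rule exp_integer_2pi) (rule Ints_of_int)
      finally have "((\<lambda>\<tau>. exp (\<i> * of_real ((real k - real j) * ln 2 * \<tau>))) has_integral 0) {t..t+T}"
        using False T0 by (intro has_integral_exp_period) auto
      from has_integral_mult_right[OF this, of "A j k"] show ?thesis using False by simp
    qed
  qed
  also have "(\<Sum>j\<in>J. \<Sum>k\<in>J. if k = j then of_real T * A j j else 0)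
      = of_real (T * (\<Sum>j\<in>J. (cmod (d j))\<^sup>2 * exp (- (2 * real j * ln 2 * \<sigma>))))"
    unfolding sum.delta[OF J] sum_distrib_left of_real_sum
  proof (intro sum.cong refl)
    fix j assume "j \<in> J"
    have "A j j = of_real ((cmod (d j))\<^sup>2 * exp (- (2 * real j * ln 2 * \<sigma>)))"
      unfolding A_def complex_norm_square of_real_mult by simp
    with \<open>j \<in> J\<close> show "(if j \<in> J then of_real T * A j j else 0)
        = complex_of_real (T * ((cmod (d j))\<^sup>2 * exp (- (2 * real j * ln 2 * \<sigma>))))"
      by simp
  qed
  finally have "((\<lambda>\<tau>. of_real ((cmod (E (Complex \<sigma> \<tau>)))\<^sup>2)) has_integral
      complex_of_real (T * (\<Sum>j\<in>J. (cmod (d j))\<^sup>2 * exp (- (2 * real j * ln 2 * \<sigma>))))) {t..t+T}"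
    unfolding E .
  from has_integral_linear[OF this bounded_linear_Re] show ?thesis
    by (simp add: o_def E_def)
qed

text \<open>The origin lies on the boundary of the half-plane and is reached by continuity along the
  positive reals.\<close>

lemma sup_norm_ge_at_0:
  assumes "continuous_on UNIV f"
  shows "ennreal (cmod (f 0)) \<le> sup_norm f"
proof (cases "sup_norm f = \<infinity>")
  case False
  then obtain B where B: "sup_norm f = ennreal B" "B \<ge> 0" by (cases "sup_norm f") auto
  then have le: "cmod (f s) \<le> B" if "Re s > 0" for s
    using sup_norm_le_iff[of B f] that by simp
  have "continuous_on UNIV (\<lambda>x::real. cmod (f (of_real x)))"
    by (intro continuous_intros continuous_on_compose2[OF assms]) auto
  then have "isCont (\<lambda>x::real. cmod (f (of_real x))) 0"
    by (simp add: continuous_on_eq_continuous_at)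
  then have "((\<lambda>x::real. cmod (f (of_real x))) \<longlongrightarrow> cmod (f 0)) (at_right 0)"
    by (auto simp: isCont_def intro: filterlim_mono[OF _ order_refl at_le])
  then have "cmod (f 0) \<le> B"
    by (rule tendsto_upperbound) (auto simp: eventually_at_filter le)
  then show ?thesis using B by (simp add: ennreal_leI)
qed simp

section \<open>Truncated logarithms\<close>

lemma sum_exp_neg_mult_eq:
  "(\<Sum>j=1..K. exp (- (real j * x))) * (exp x - 1) = 1 - exp (- (real K * x))"
proof (induction K)
  case (Suc K)
  have "exp (- (real (Suc K) * x)) * exp x = exp (- (real K * x))"
    by (simp add: algebra_simps flip: exp_add)
  with Suc show ?case by (simp add: algebra_simps)
qed simp

text \<open>Both bounds compare with \<open>exp x - 1\<close> in the geometric sum. The first gives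
  the Bloch bound; the second keeps exponential decay in \<open>x\<close>, so that the Carleson
  integral over \<open>\<sigma>\<close> stays bounded uniformly in \<open>h\<close> and
  \<open>K\<close>.\<close>

lemma mult_sum_exp_neg_le:
  assumes "x \<ge> 0"
  shows "x * (\<Sum>j=1..K. exp (- (real j * x))) \<le> 1"
    and "x * (\<Sum>j=1..K. exp (- (real j * x))) \<le> 2 * exp (- (x / 2))"
proof -
  let ?S = "\<Sum>j=1..K. exp (- (real j * x))"
  have S: "?S \<ge> 0" by (intro sum_nonneg) simp
  have S1: "?S * (exp x - 1) \<le> 1" unfolding sum_exp_neg_mult_eq by simp
  have "x \<le> exp x - 1" using exp_ge_add_one_self[of x] by linarith
  from mult_left_mono[OF this S] S1 show "x * ?S \<le> 1" by (simp add: mult.commute)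
  \<comment> \<open>The factorization of \<open>exp x - 1\<close> as a difference of squares saves
    the factor \<open>exp (x / 2)\<close>.\<close>
  have "x / 2 * exp (x / 2) \<le> (exp (x / 2) - 1) * (exp (x / 2) + 1)"
    using exp_ge_add_one_self[of "x / 2"] assms by (intro mult_mono) linarith+
  also have "\<dots> = exp x - 1" by (simp add: algebra_simps flip: exp_add)
  finally have "x * exp (x / 2) \<le> 2 * (exp x - 1)" by simp
  from mult_left_mono[OF this S] S1 have "x * ?S * exp (x / 2) \<le> 2" by (simp add: algebra_simps)
  then show "x * ?S \<le> 2 * exp (- (x / 2))" by (simp add: exp_minus field_simps)
qed

text \<open>A partial sum of \<open>- ln (1 - 2 powr (- s))\<close>, chosen because its derivative
  is a geometric sum.\<close>

definition log_poly :: "nat \<Rightarrow> complex \<Rightarrow> complex" where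
  "log_poly K = exp_sum {1..K} (\<lambda>j. 1 / of_nat j) (\<lambda>j. real j * ln 2)"

lemma deriv_log_poly:
  "deriv (log_poly K) = exp_sum {1..K} (\<lambda>j. - of_real (ln 2)) (\<lambda>j. real j * ln 2)"
  unfolding log_poly_def deriv_exp_sum unfolding exp_sum_def
  by (intro ext sum.cong) auto

lemma bloch_norm_log_poly_le: "bloch_norm (log_poly K) \<le> 1"
proof -
  have "\<sigma> * cmod (deriv (log_poly K) (Complex \<sigma> t)) \<le> 1" if "\<sigma> > 0" for \<sigma> t
  proof -
    have "cmod (deriv (log_poly K) (Complex \<sigma> t)) \<le> (\<Sum>j=1..K. ln 2 * exp (- (real j * ln 2 * \<sigma>)))"
      unfolding deriv_log_poly by (rule order_trans[OF norm_exp_sum_le]) simp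
    also have "\<dots> = ln 2 * (\<Sum>j=1..K. exp (- (real j * (ln 2 * \<sigma>))))"
      by (simp add: sum_distrib_left mult.assoc)
    finally have "\<sigma> * cmod (deriv (log_poly K) (Complex \<sigma> t))
        \<le> (ln 2 * \<sigma>) * (\<Sum>j=1..K. exp (- (real j * (ln 2 * \<sigma>))))"
      using that by (simp add: mult_left_mono mult_ac)
    also have "\<dots> \<le> 1" by (rule mult_sum_exp_neg_le) (use that in simp)
    finally show ?thesis .
  qed
  then show ?thesis using bloch_norm_le_iff[of 1 "log_poly K"] by simp
qed

text \<open>Enlarging \<open>{t..t+h}\<close> to whole periods makes Parseval's identity available
  at the cost of replacing \<open>h\<close> by at most \<open>h + P\<close>. For small
  \<open>h\<close> this loss is compensated by the shortness of the range of
  \<open>\<sigma>\<close>.\<close>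

lemma carleson_log_poly_le:
  assumes h: "h > 0"
  shows "carleson (deriv (log_poly K)) h t \<le> 3\<^sup>2 * h"
proof -
  define P where "P = 2 * pi / ln 2"
  define m where "m = nat \<lceil>h / P\<rceil>"
  define T where "T = real m * P"
  have P: "P > 0" by (simp add: P_def)
  have "h / P \<le> real m" "real m \<le> h / P + 1"
    unfolding m_def using h P by (auto simp: real_nat_ceiling_ge of_nat_nat intro: of_int_ceiling_le_add_one)
  then have hT: "h \<le> T" "T \<le> h + P"
    using P by (auto simp: T_def field_simps)
  have cont: "continuous_on UNIV (deriv (log_poly K))"
    unfolding deriv_log_poly by (intro continuous_intros)
  have "carleson (deriv (log_poly K)) h t \<le> integral {0..h} (\<lambda>\<sigma>. (h + P) * (ln 2 * exp (- (ln 2 * \<sigma>))))"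
    unfolding carleson_def
  proof (rule integral_le)
    fix \<sigma> assume "\<sigma> \<in> {0..h}"
    then have \<sigma>: "\<sigma> \<ge> 0" by simp
    have "integral {t..t+h} (\<lambda>\<tau>. (cmod (deriv (log_poly K) (Complex \<sigma> \<tau>)))\<^sup>2 * \<sigma>)
        \<le> integral {t..t+T} (\<lambda>\<tau>. (cmod (deriv (log_poly K) (Complex \<sigma> \<tau>)))\<^sup>2 * \<sigma>)"
      using hT \<sigma>
      by (intro integral_subset_le integrable_continuous_real continuous_carleson_integrand cont continuous_intros)
        auto
    also have "\<dots> = T * (\<Sum>j=1..K. (ln 2)\<^sup>2 * exp (- (2 * real j * ln 2 * \<sigma>))) * \<sigma>"
      using has_integral_mult_left[OF exp_sum_parseval[of "{1..K}" T m "\<lambda>j. - of_real (ln 2)" \<sigma> t], of \<sigma>]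
      unfolding deriv_log_poly by (intro integral_unique) (simp add: T_def P_def)
    also have "\<dots> = T * ((ln 2 / 2) * ((2 * ln 2 * \<sigma>) * (\<Sum>j=1..K. exp (- (real j * (2 * ln 2 * \<sigma>))))))"
      by (simp add: sum_distrib_left sum_distrib_right power2_eq_square mult_ac)
    also have "\<dots> \<le> (h + P) * ((ln 2 / 2) * (2 * exp (- (2 * ln 2 * \<sigma> / 2))))"
      using hT h \<sigma> by (intro mult_mono mult_left_mono mult_sum_exp_neg_le(2) mult_nonneg_nonneg sum_nonneg) auto
    finally show "integral {t..t+h} (\<lambda>\<tau>. (cmod (deriv (log_poly K) (Complex \<sigma> \<tau>)))\<^sup>2 * \<sigma>)
        \<le> (h + P) * (ln 2 * exp (- (ln 2 * \<sigma>)))" by simp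
  next
    show "(\<lambda>\<sigma>. (h + P) * (ln 2 * exp (- (ln 2 * \<sigma>)))) integrable_on {0..h}"
      by (intro integrable_continuous_real continuous_intros)
  qed (intro integrable_continuous_real continuous_carleson_inner cont)
  also have "\<dots> = - ((h + P) * exp (- (ln 2 * h))) - - ((h + P) * exp (- (ln 2 * 0)))"
    using h by (intro integral_unique fundamental_theorem_of_calculus)
      (auto intro!: derivative_eq_intros simp flip: has_real_derivative_iff_has_vector_derivative)
  also have "\<dots> = (h + P) * (1 - exp (- (ln 2 * h)))" by (simp add: algebra_simps)
  also have "\<dots> = h * (1 - exp (- (ln 2 * h))) + P * (1 - exp (- (ln 2 * h)))" by (simp add: algebra_simps)
  \<comment> \<open>The factor \<open>1 - exp (- (ln 2 * h))\<close> is bounded by 1 in the first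
    term and by \<open>ln 2 * h\<close> in the second. As \<open>P * ln 2 = 2 * pi\<close>, the
    total is \<open>(1 + 2 * pi) * h\<close>, below \<open>9 * h\<close>.\<close>
  also have "\<dots> \<le> h * 1 + P * (ln 2 * h)"
    using exp_ge_add_one_self[of "- (ln 2 * h)"] h P by (intro add_mono mult_left_mono) auto
  also have "\<dots> \<le> 3\<^sup>2 * h"
    using h pi_less_4 by (simp add: P_def algebra_simps)
  finally show ?thesis .
qed

lemma bmoa_norm_log_poly_le: "bmoa_norm (log_poly K) \<le> ennreal 3"
proof (rule bmoa_norm_leI)
  show "continuous_on UNIV (deriv (log_poly K))" unfolding deriv_log_poly by (intro continuous_intros)
qed (use carleson_log_poly_le in auto)

lemma log_poly_0: "log_poly K 0 = of_real (harm K)"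
  by (simp add: log_poly_def exp_sum_def harm_def divide_inverse)

lemma sup_norm_log_poly_ge: "ennreal (ln (real K + 1)) \<le> sup_norm (log_poly K)"
proof -
  have "ln (real K + 1) \<le> harm K" using ln_le_harm[of K] by (simp add: add.commute)
  also have "harm K = cmod (log_poly K 0)" by (simp add: log_poly_0 harm_nonneg)
  also have "continuous_on UNIV (log_poly K)" unfolding log_poly_def by (intro continuous_intros)
  from sup_norm_ge_at_0[OF this] have "ennreal (cmod (log_poly K 0)) \<le> sup_norm (log_poly K)" .
  finally show ?thesis by (simp add: ennreal_leI order_trans)
qed

lemma log_poly_mem:
  assumes "2 ^ K \<le> N" "K \<ge> 1"
  shows "log_poly K \<in> dirichlet_polys N - {\<lambda>_. 0}"
proof -
  have "harm K \<noteq> (0::real)" using assms(2) by (intro less_imp_neq[THEN not_sym] harm_pos) simp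
  then have "log_poly K 0 \<noteq> 0" unfolding log_poly_0 of_real_eq_0_iff .
  then have "log_poly K \<noteq> (\<lambda>_. 0)" by auto
  moreover have "log_poly K \<in> dirichlet_polys N"
    unfolding log_poly_def
  proof (rule exp_sum_powers_of_two_mem_dirichlet_polys)
    show "1 \<le> j \<and> 2 ^ j \<le> N" if "j \<in> {1..K}" for j
      using that order_trans[OF power_increasing[of j K "2::nat"] assms(1)] by simp
  qed simp
  ultimately show ?thesis by simp
qed

section \<open>Lacunary polynomials\<close>

definition lacunary_poly :: "nat \<Rightarrow> complex \<Rightarrow> complex" where
  "lacunary_poly K = exp_sum ((^) 2 ` {..<K}) (\<lambda>_. 1) (\<lambda>j. real j * ln 2)"

lemma sum_powers_of_two: "(\<Sum>j\<in>((^) (2::nat)) ` {..<K}. u j) = (\<Sum>k<K. u (2 ^ k))"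
  by (subst sum.reindex) (auto simp: inj_on_def)

lemma deriv_lacunary_poly:
  "deriv (lacunary_poly K)
    = exp_sum ((^) 2 ` {..<K}) (\<lambda>j. - of_real (real j * ln 2)) (\<lambda>j. real j * ln 2)"
  unfolding lacunary_poly_def deriv_exp_sum by simp

text \<open>Each summand is at most twice the integral of \<open>exp (- u)\<close> over \<open>[2 ^ k * y / 2, 2 ^ k * y]\<close>,
  and these intervals do not overlap.\<close>

lemma lacunary_sum_le:
  fixes y :: real
  assumes "y \<ge> 0"
  shows "(\<Sum>k<K. (2 ^ k * y) * exp (- (2 ^ k * y))) \<le> 2"
proof -
  have step: "z * exp (- z) \<le> 2 * (exp (- (z / 2)) - exp (- z))" for z :: real
  proof -
    have "exp (- (z / 2)) = exp (- z) * exp (z / 2)" by (simp flip: exp_add)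
    moreover have "exp (- z) * (1 + z / 2) \<le> exp (- z) * exp (z / 2)"
      by (intro mult_left_mono exp_ge_add_one_self) simp
    ultimately show ?thesis by (simp add: algebra_simps)
  qed
  have "(\<Sum>k<K. (2 ^ k * y) * exp (- (2 ^ k * y)))
      \<le> (\<Sum>k<K. 2 * (exp (- (2 ^ k * y / 2)) - exp (- (2 ^ Suc k * y / 2))))"
    using step[of "2 ^ k * y" for k] by (intro sum_mono) simp
  also have "\<dots> = 2 * (exp (- (y / 2)) - exp (- (2 ^ K * y / 2)))"
    unfolding sum_distrib_left[symmetric]
    using sum_lessThan_telescope'[of "\<lambda>k. exp (- (2 ^ k * y / 2))" K] by simp
  also have "\<dots> \<le> 2 * (1 - 0)" using assms by (intro mult_left_mono diff_mono) auto
  finally show ?thesis by simp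
qed

lemma bloch_norm_lacunary_poly_le: "bloch_norm (lacunary_poly K) \<le> ennreal 2"
proof (subst bloch_norm_le_iff, simp, intro allI impI)
  fix \<sigma> t :: real assume \<sigma>: "\<sigma> > 0"
  have "cmod (deriv (lacunary_poly K) (Complex \<sigma> t))
      \<le> (\<Sum>j\<in>((^) 2) ` {..<K}. real j * ln 2 * exp (- (real j * ln 2 * \<sigma>)))"
    unfolding deriv_lacunary_poly by (rule order_trans[OF norm_exp_sum_le]) (simp add: norm_mult)
  also have "\<dots> = (\<Sum>k<K. 2 ^ k * ln 2 * exp (- (2 ^ k * ln 2 * \<sigma>)))"
    by (simp add: sum_powers_of_two)
  finally have "\<sigma> * cmod (deriv (lacunary_poly K) (Complex \<sigma> t))
      \<le> \<sigma> * (\<Sum>k<K. 2 ^ k * ln 2 * exp (- (2 ^ k * ln 2 * \<sigma>)))"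
    using \<sigma> by (simp add: mult_left_mono)
  also have "\<dots> = (\<Sum>k<K. (2 ^ k * (ln 2 * \<sigma>)) * exp (- (2 ^ k * (ln 2 * \<sigma>))))"
    by (simp add: sum_distrib_left mult_ac)
  also have "\<dots> \<le> 2" by (rule lacunary_sum_le) (use \<sigma> in simp)
  finally show "\<sigma> * cmod (deriv (lacunary_poly K) (Complex \<sigma> t)) \<le> 2" .
qed

text \<open>The Carleson square has one period \<open>P\<close> as its side, so Parseval's identity
  is exact. Every frequency \<open>l\<close> contributes nearly \<open>P / 4\<close>, since the
  integral of \<open>l^2 * \<sigma> * exp (- 2 * l * \<sigma>)\<close> over the half-line is
  \<open>1 / 4\<close> whatever \<open>l\<close> is; half of this is kept for each of the
  \<open>K\<close> frequencies.\<close>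

lemma bmoa_norm_lacunary_poly_ge: "ennreal (sqrt (real K / 8)) \<le> bmoa_norm (lacunary_poly K)"
proof (rule bmoa_norm_geI)
  define P where "P = 2 * pi / ln 2"
  have P: "P > 0" by (simp add: P_def)
  then show "2 * pi / ln 2 > 0" by (simp add: P_def)
  define J where "J = (^) (2::nat) ` {..<K}"
  have J: "finite J" "card J = K" "\<And>j. j \<in> J \<Longrightarrow> j \<ge> 1"
    unfolding J_def by (auto simp: card_image inj_on_def)
  \<comment> \<open>A primitive of the contribution of \<open>j\<close>, obtained by integration by
    parts; its value at 0 is \<open>- P / 4\<close>.\<close>
  define W where "W j \<sigma> = - (P * (\<sigma> * (real j * ln 2) / 2 + 1 / 4)) * exp (- (2 * real j * ln 2 * \<sigma>))"
    for j \<sigma>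
  show cont: "continuous_on UNIV (deriv (lacunary_poly K))"
    unfolding deriv_lacunary_poly by (intro continuous_intros)
  have "carleson (deriv (lacunary_poly K)) P 0
      = integral {0..P} (\<lambda>\<sigma>. \<Sum>j\<in>J. P * ((real j * ln 2)\<^sup>2 * exp (- (2 * real j * ln 2 * \<sigma>))) * \<sigma>)"
    unfolding carleson_def
  proof (intro Henstock_Kurzweil_Integration.integral_cong)
    fix \<sigma> assume "\<sigma> \<in> {0..P}"
    have "P = real 1 * (2 * pi / ln 2)" by (simp add: P_def)
    from has_integral_mult_left[OF exp_sum_parseval[OF J(1) this,
          of "\<lambda>j. - of_real (real j * ln 2)" \<sigma> 0], of \<sigma>]
    show "integral {0..0+P} (\<lambda>\<tau>. (cmod (deriv (lacunary_poly K) (Complex \<sigma> \<tau>)))\<^sup>2 * \<sigma>)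
      = (\<Sum>j\<in>J. P * ((real j * ln 2)\<^sup>2 * exp (- (2 * real j * ln 2 * \<sigma>))) * \<sigma>)"
      unfolding deriv_lacunary_poly J_def[symmetric]
      by (intro integral_unique) (simp add: sum_distrib_left sum_distrib_right norm_mult)
  qed
  also have "\<dots> = (\<Sum>j\<in>J. W j P - W j 0)"
  proof (intro integral_unique has_integral_sum J(1) fundamental_theorem_of_calculus)
    fix j x
    define l where "l = real j * ln 2"
    have "((\<lambda>\<sigma>. - (P * (\<sigma> * l / 2 + 1 / 4)) * exp (- (2 * l * \<sigma>))) has_real_derivative
        P * (l\<^sup>2 * exp (- (2 * l * x))) * x) (at x)"
      by (auto intro!: derivative_eq_intros simp: field_simps power2_eq_square)
    then have "(W j has_real_derivative P * ((real j * ln 2)\<^sup>2 * exp (- (2 * real j * ln 2 * x))) * x) (at x)"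
      unfolding W_def[abs_def] l_def by (simp only: mult.assoc)
    then show "(W j has_vector_derivative P * ((real j * ln 2)\<^sup>2 * exp (- (2 * real j * ln 2 * x))) * x)
        (at x within {0..P})"
      by (simp add: has_real_derivative_iff_has_vector_derivative has_vector_derivative_at_within)
  qed (use P in simp)
  also have "\<dots> \<ge> (\<Sum>j\<in>J. P / 8)"
  proof (rule sum_mono)
    fix j assume "j \<in> J"
    \<comment> \<open>Since \<open>P\<close> is the period, \<open>v = 2 * pi * j\<close>, which is
      at least 6. The part of the integral beyond \<open>P\<close> is then at most
      \<open>P / 8\<close>.\<close>
    define v where "v = P * (real j * ln 2)"
    have "v = 2 * pi * real j" by (simp add: v_def P_def)
    moreover have "3 * 1 \<le> pi * real j" using J(3)[OF \<open>j \<in> J\<close>] pi_gt3 by (intro mult_mono) auto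
    ultimately have v: "v \<ge> 6" by simp
    then have "6 * v \<le> v * v" by (intro mult_right_mono) auto
    with v have "2 * v + 1 \<le> 2 * (v * v)" by linarith
    then have "2 * (1 + 2 * v) \<le> 1 + 2 * v + (2 * v)\<^sup>2 / 2" by (simp add: power2_eq_square)
    also have "\<dots> \<le> exp (2 * v)" using v by (intro exp_lower_Taylor_quadratic) simp
    finally have "(v / 2 + 1 / 4) * exp (- (2 * v)) \<le> 1 / 8"
      by (simp add: exp_minus field_simps)
    from mult_left_mono[OF this, of P] P have "P / 8 \<le> P / 4 - P * (v / 2 + 1 / 4) * exp (- (2 * v))"
      by (simp add: mult_ac)
    moreover have "2 * real j * ln 2 * P = 2 * v" "P * (real j * ln 2) / 2 = v / 2" by (simp_all add: v_def)
    then have "W j P = - (P * (v / 2 + 1 / 4) * exp (- (2 * v)))" by (simp only: W_def mult_minus_left)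
    moreover have "W j 0 = - (P / 4)" by (simp add: W_def)
    ultimately show "P / 8 \<le> W j P - W j 0" by linarith
  qed
  finally show "(sqrt (real K / 8))\<^sup>2 * (2 * pi / ln 2) \<le> carleson (deriv (lacunary_poly K)) (2 * pi / ln 2) 0"
    by (simp add: J P_def mult.commute)
qed simp

lemma lacunary_poly_mem:
  assumes K: "\<And>k. k < K \<Longrightarrow> 2 ^ (2 ^ k) \<le> N" and "K \<ge> 1"
  shows "lacunary_poly K \<in> dirichlet_polys N - {\<lambda>_. 0}"
proof -
  have "lacunary_poly K 0 = of_nat K"
    by (simp add: lacunary_poly_def exp_sum_def card_image inj_on_def)
  with \<open>K \<ge> 1\<close> have "lacunary_poly K \<noteq> (\<lambda>_. 0)" by force
  moreover have "lacunary_poly K \<in> dirichlet_polys N"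
    unfolding lacunary_poly_def
    by (rule exp_sum_powers_of_two_mem_dirichlet_polys) (use K in auto)
  ultimately show ?thesis by simp
qed

section \<open>Comparison of the norms\<close>

text \<open>The degenerate denominators are covered: \<open>b = 0\<close> forces
  \<open>a = 0\<close>, and zero divided by zero is zero; for infinite \<open>b\<close> the quotient
  is zero.\<close>

lemma ennreal_divide_le_if_le_mult:
  fixes a b :: ennreal
  assumes "a \<le> ennreal c * b"
  shows "a / b \<le> ennreal c"
proof (cases "b = 0 \<or> b = \<infinity>")
  case True
  then show ?thesis using assms by auto
next
  case False
  then have "a / b \<le> ennreal c * b / b" using assms by (intro divide_right_mono_ennreal)
  also have "\<dots> = ennreal c" using False by (simp add: ennreal_mult_divide_eq)
  finally show ?thesis .
qed

text \<open>The inverse is antitone on all of \<open>ennreal\<close>; a zero denominator has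
  infinite inverse.\<close>

lemma le_ennreal_divide_if_bounds:
  fixes a b :: ennreal
  assumes "ennreal x \<le> a" "b \<le> ennreal B" "B > 0" "x \<ge> 0"
  shows "ennreal (x / B) \<le> a / b"
proof -
  have inv: "inverse (ennreal B) \<le> inverse b"
  proof (cases b)
    case (real r)
    then show ?thesis
      using assms by (cases "r = 0") (simp_all add: inverse_ennreal le_imp_inverse_le ennreal_leI)
  qed (use assms(2) in \<open>auto simp: top_unique\<close>)
  have "ennreal (x / B) = ennreal x / ennreal B" using assms by (simp add: divide_ennreal)
  also have "\<dots> \<le> a / ennreal B" using assms(1) by (rule divide_right_mono_ennreal)
  also have "\<dots> \<le> a / b"
    unfolding divide_ennreal_def by (intro mult_left_mono inv) simp
  finally show ?thesis .
qed

section \<open>Choice of the extremal polynomials for a given length\<close>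

lemma power_interval:
  assumes "n \<ge> 2"
  obtains m :: nat where "m \<ge> 1" "2 ^ m \<le> n" "n < (2::nat) ^ (m + 1)"
proof -
  obtain m where m: "2 ^ m \<le> n" "n < (2::nat) ^ (m + 1)"
    using ex_power_ivl1[of 2 n] assms by auto
  then have "m \<noteq> 0" using assms by (intro notI) simp
  with m show ?thesis by (intro that[of m]) auto
qed

lemma ln_less_if_less_two_power:
  assumes "real n < 2 ^ k" "n \<ge> 1"
  shows "ln (real n) < k"
proof -
  have "ln (real n) < ln (2 ^ k)" using assms by (subst ln_less_cancel_iff) auto
  also have "\<dots> = real k * ln 2" by (simp add: ln_realpow)
  also have "\<dots> \<le> real k * 1" using ln2_le_25_over_36 by (intro mult_left_mono) auto
  finally show ?thesis by simp
qed

text \<open>\<open>K\<close> is the integer part of the binary logarithm of \<open>N\<close>. From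
  \<open>ln N < K + 1\<close> and the lower bound \<open>ln (K + 1)\<close> for the harmonic number,
  \<open>ln (ln N)\<close> is reached without any additive loss.\<close>

lemma log_poly_witness:
  assumes "N \<ge> 2"
  obtains K where "log_poly K \<in> dirichlet_polys N - {\<lambda>_. 0}"
    "ennreal (ln (ln (real N))) \<le> sup_norm (log_poly K)"
proof -
  obtain K where K: "K \<ge> 1" "2 ^ K \<le> N" "N < (2::nat) ^ (K + 1)"
    using power_interval[OF assms] .
  have "real N < 2 ^ (K + 1)" using K(3) by (metis of_nat_less_iff of_nat_numeral of_nat_power)
  then have "ln (real N) < real (K + 1)" by (rule ln_less_if_less_two_power) (use assms in simp)
  moreover have "ln (real N) > 0" using assms by simp
  ultimately have "ln (ln (real N)) \<le> ln (real K + 1)" by (intro ln_mono) auto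
  then have "ennreal (ln (ln (real N))) \<le> ennreal (ln (real K + 1))" by (rule ennreal_leI)
  also note sup_norm_log_poly_ge
  finally show ?thesis by (intro that[of K] log_poly_mem K)
qed

text \<open>Two successive binary logarithms: \<open>m\<close> from \<open>N\<close>, then
  \<open>k\<close> from \<open>m\<close>. The \<open>k + 1\<close> exponents \<open>2 ^ i\<close>
  with \<open>i \<le> k\<close> are all at most \<open>m\<close>. The assumption
  \<open>N \<ge> 4\<close> gives \<open>m \<ge> 2\<close>, as the second step requires.\<close>

lemma lacunary_poly_witness:
  assumes "N \<ge> 4"
  obtains K where "lacunary_poly K \<in> dirichlet_polys N - {\<lambda>_. 0}" "ln (ln (real N)) \<le> real K"
proof -
  obtain m where m: "m \<ge> 1" "2 ^ m \<le> N" "N < (2::nat) ^ (m + 1)"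
    using power_interval[of N] assms by auto
  have "m \<ge> 2"
  proof (rule ccontr)
    assume "\<not> m \<ge> 2"
    with m(1) have "m = 1" by simp
    with m(3) assms show False by simp
  qed
  then obtain k where k: "k \<ge> 1" "2 ^ k \<le> m" "m < (2::nat) ^ (k + 1)" by (rule power_interval)
  have "real N < 2 ^ (m + 1)" using m(3) by (metis of_nat_less_iff of_nat_numeral of_nat_power)
  then have "ln (real N) < real (m + 1)" by (rule ln_less_if_less_two_power) (use assms in simp)
  \<comment> \<open>The strict inequality \<open>m < 2 ^ (k + 1)\<close> absorbs the 1 in
    \<open>m + 1\<close>.\<close>
  also have "\<dots> \<le> real (2 ^ (k + 1))" using k(3) by (intro of_nat_mono) simp
  finally have "ln (real N) < 2 ^ (k + 1)" by simp
  moreover have "ln (real N) > 0" using assms by simp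
  ultimately have "ln (ln (real N)) < ln (2 ^ (k + 1))" by (subst ln_less_cancel_iff) auto
  also have "\<dots> = real (k + 1) * ln 2" by (subst ln_realpow) auto
  also have "\<dots> \<le> real (k + 1) * 1" using ln2_le_25_over_36 by (intro mult_left_mono) auto
  finally have "ln (ln (real N)) \<le> real (k + 1)" by simp
  moreover have "lacunary_poly (k + 1) \<in> dirichlet_polys N - {\<lambda>_. 0}"
  proof (rule lacunary_poly_mem)
    fix i assume "i < k + 1"
    then have "(2::nat) ^ i \<le> 2 ^ k" by (intro power_increasing) auto
    also note k(2)
    finally have "2 ^ i \<le> m" .
    then have "(2::nat) ^ (2 ^ i) \<le> 2 ^ m" by (intro power_increasing) auto
    also note m(2)
    finally show "2 ^ (2 ^ i) \<le> N" .
  qed simp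
  ultimately show ?thesis by (rule that[rotated])
qed

theorem theorem4p1:
  shows "ennreal_asymp_equiv
           (\<lambda>N. SUP f\<in>dirichlet_polys N - {\<lambda>_. 0}. sup_norm f / bloch_norm f)
           (\<lambda>N. ln (ln (real N))) \<and>
         ennreal_same_order
           (\<lambda>N. SUP f\<in>dirichlet_polys N - {\<lambda>_. 0}. bmoa_norm f / bloch_norm f)
           (\<lambda>N. sqrt (ln (ln (real N)))) \<and>
         ennreal_same_order
           (\<lambda>N. SUP f\<in>dirichlet_polys N - {\<lambda>_. 0}. sup_norm f / bmoa_norm f)
           (\<lambda>N. ln (ln (real N)))"
proof -
  define A where "A N = (SUP f\<in>dirichlet_polys N - {\<lambda>_. 0}. sup_norm f / bloch_norm f)" for N
  define LL where "LL N = ln (ln (real N))" for N :: nat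
  have LL_at_top: "filterlim LL at_top sequentially"
    unfolding LL_def
    by (intro filterlim_compose[OF ln_at_top] filterlim_real_sequentially)
  have "filterlim (\<lambda>N. ln (real N)) at_top sequentially"
    by (intro filterlim_compose[OF ln_at_top] filterlim_real_sequentially)
  \<comment> \<open>The first two conditions serve the BMOA upper bound and the lacunary witness.
    The third gives \<open>LL N + 5 \<le> 2 * LL N\<close>, which absorbs the additive
    constant.\<close>
  then have large: "\<forall>\<^sub>F N in sequentially. ln (real N) \<ge> 2 \<and> N \<ge> 4 \<and> LL N \<ge> 5"
    using LL_at_top eventually_ge_at_top[of 4]
    by (auto simp: filterlim_at_top eventually_conj_iff)
  have "ennreal_asymp_equiv A LL"
    unfolding ennreal_asymp_equiv_def
  proof (rule tendsto_sandwich)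
    show "\<forall>\<^sub>F N in sequentially. 1 \<le> A N / ennreal (LL N)"
      using large
    proof eventually_elim
      fix N assume N: "ln (real N) \<ge> 2 \<and> N \<ge> 4 \<and> LL N \<ge> 5"
      then obtain K where K: "log_poly K \<in> dirichlet_polys N - {\<lambda>_. 0}"
        "ennreal (LL N) \<le> sup_norm (log_poly K)"
        using log_poly_witness[of N] unfolding LL_def by auto
      have "ennreal (LL N / 1) \<le> sup_norm (log_poly K) / bloch_norm (log_poly K)"
        using K N bloch_norm_log_poly_le[of K] by (intro le_ennreal_divide_if_bounds) auto
      also have "\<dots> \<le> A N" unfolding A_def by (rule SUP_upper[OF K(1)])
      finally have "ennreal (LL N) \<le> A N" by simp
      then have "ennreal (LL N) / ennreal (LL N) \<le> A N / ennreal (LL N)" by (rule divide_right_mono_ennreal)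
      then show "1 \<le> A N / ennreal (LL N)" using N by (simp add: divide_ennreal)
    qed
    show "\<forall>\<^sub>F N in sequentially. A N / ennreal (LL N) \<le> ennreal (1 + 5 / LL N)"
      using large
    proof eventually_elim
      fix N assume N: "ln (real N) \<ge> 2 \<and> N \<ge> 4 \<and> LL N \<ge> 5"
      then have "A N \<le> ennreal (LL N + 5)"
        unfolding A_def LL_def
        by (intro SUP_least ennreal_divide_le_if_le_mult sup_norm_le_bloch_norm) auto
      then have "A N / ennreal (LL N) \<le> ennreal (LL N + 5) / ennreal (LL N)"
        by (rule divide_right_mono_ennreal)
      also have "\<dots> = ennreal ((LL N + 5) / LL N)" using N by (intro divide_ennreal) auto
      also have "(LL N + 5) / LL N = 1 + 5 / LL N" using N by (simp add: add_divide_distrib)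
      finally show "A N / ennreal (LL N) \<le> ennreal (1 + 5 / LL N)" .
    qed
    have "(\<lambda>N. 5 / LL N) \<longlonglongrightarrow> 0"
      by (rule real_tendsto_divide_at_top[OF tendsto_const LL_at_top])
    then have "(\<lambda>N. ennreal (1 + 5 / LL N)) \<longlonglongrightarrow> ennreal (1 + 0)"
      by (intro tendsto_ennrealI tendsto_add tendsto_const)
    then show "(\<lambda>N. ennreal (1 + 5 / LL N)) \<longlonglongrightarrow> 1" by simp
  qed simp
  moreover have "ennreal_same_order
      (\<lambda>N. SUP f\<in>dirichlet_polys N - {\<lambda>_. 0}. bmoa_norm f / bloch_norm f) (\<lambda>N. sqrt (LL N))"
    unfolding ennreal_same_order_def
  proof (intro exI conjI)
    show "\<forall>\<^sub>F N in sequentially.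
      ennreal (1 / 6 * sqrt (LL N)) \<le> (SUP f\<in>dirichlet_polys N - {\<lambda>_. 0}. bmoa_norm f / bloch_norm f) \<and>
      (SUP f\<in>dirichlet_polys N - {\<lambda>_. 0}. bmoa_norm f / bloch_norm f) \<le> ennreal (46 * sqrt (LL N))"
      using large
    proof (eventually_elim, intro conjI)
      fix N assume N: "ln (real N) \<ge> 2 \<and> N \<ge> 4 \<and> LL N \<ge> 5"
      then obtain K where K: "lacunary_poly K \<in> dirichlet_polys N - {\<lambda>_. 0}" "LL N \<le> real K"
        using lacunary_poly_witness[of N] unfolding LL_def by auto
      \<comment> \<open>The lower bound \<open>sqrt (K / 8)\<close> for the BMOA norm over the Bloch
        bound 2 is \<open>sqrt (K / 32)\<close>, and \<open>32 \<le> 36\<close>.\<close>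
      have "1 / 6 * sqrt (LL N) \<le> sqrt (real K / 8) / 2"
      proof (rule power2_le_imp_le)
        show "(1 / 6 * sqrt (LL N))\<^sup>2 \<le> (sqrt (real K / 8) / 2)\<^sup>2"
          using N K(2) by (simp add: power_mult_distrib power_divide)
      qed simp
      then have "ennreal (1 / 6 * sqrt (LL N)) \<le> ennreal (sqrt (real K / 8) / 2)" by (rule ennreal_leI)
      also have "\<dots> \<le> bmoa_norm (lacunary_poly K) / bloch_norm (lacunary_poly K)"
        by (intro le_ennreal_divide_if_bounds bmoa_norm_lacunary_poly_ge bloch_norm_lacunary_poly_le) auto
      also have "\<dots> \<le> (SUP f\<in>dirichlet_polys N - {\<lambda>_. 0}. bmoa_norm f / bloch_norm f)"
        by (rule SUP_upper[OF K(1)])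
      finally show "ennreal (1 / 6 * sqrt (LL N))
          \<le> (SUP f\<in>dirichlet_polys N - {\<lambda>_. 0}. bmoa_norm f / bloch_norm f)" .
      show "(SUP f\<in>dirichlet_polys N - {\<lambda>_. 0}. bmoa_norm f / bloch_norm f) \<le> ennreal (46 * sqrt (LL N))"
        unfolding LL_def using N
        by (intro SUP_least ennreal_divide_le_if_le_mult bmoa_norm_le_bloch_norm) auto
    qed
  qed simp_all
  moreover have "ennreal_same_order
      (\<lambda>N. SUP f\<in>dirichlet_polys N - {\<lambda>_. 0}. sup_norm f / bmoa_norm f) LL"
    unfolding ennreal_same_order_def
  proof (intro exI conjI)
    show "\<forall>\<^sub>F N in sequentially.
      ennreal (1 / 3 * LL N) \<le> (SUP f\<in>dirichlet_polys N - {\<lambda>_. 0}. sup_norm f / bmoa_norm f) \<and>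
      (SUP f\<in>dirichlet_polys N - {\<lambda>_. 0}. sup_norm f / bmoa_norm f) \<le> ennreal (12 * LL N)"
      using large
    proof (eventually_elim, intro conjI)
      fix N assume N: "ln (real N) \<ge> 2 \<and> N \<ge> 4 \<and> LL N \<ge> 5"
      then obtain K where K: "log_poly K \<in> dirichlet_polys N - {\<lambda>_. 0}"
        "ennreal (LL N) \<le> sup_norm (log_poly K)"
        using log_poly_witness[of N] unfolding LL_def by auto
      have "ennreal (LL N / 3) \<le> sup_norm (log_poly K) / bmoa_norm (log_poly K)"
        using K N by (intro le_ennreal_divide_if_bounds bmoa_norm_log_poly_le) auto
      also have "\<dots> \<le> (SUP f\<in>dirichlet_polys N - {\<lambda>_. 0}. sup_norm f / bmoa_norm f)"
        by (rule SUP_upper[OF K(1)])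
      finally show "ennreal (1 / 3 * LL N) \<le> (SUP f\<in>dirichlet_polys N - {\<lambda>_. 0}. sup_norm f / bmoa_norm f)"
        by simp
      show "(SUP f\<in>dirichlet_polys N - {\<lambda>_. 0}. sup_norm f / bmoa_norm f) \<le> ennreal (12 * LL N)"
      proof (intro SUP_least ennreal_divide_le_if_le_mult)
        fix f assume "f \<in> dirichlet_polys N - {\<lambda>_. 0}"
        then have f: "f \<in> dirichlet_polys N" by simp
        \<comment> \<open>The Bloch norm is the intermediate quantity: its factor
          \<open>LL N + 5\<close> is at most \<open>2 * LL N\<close>, and the passage to the BMOA
          norm costs 6, together 12.\<close>
        have "sup_norm f \<le> ennreal (LL N + 5) * bloch_norm f"
          unfolding LL_def by (rule sup_norm_le_bloch_norm[OF f]) (use N in simp)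
        also have "\<dots> \<le> ennreal (LL N + 5) * (ennreal 6 * bmoa_norm f)"
          by (intro mult_left_mono bloch_norm_le_bmoa_norm holomorphic_deriv_dirichlet_poly[OF f]) simp
        also have "\<dots> = ennreal ((LL N + 5) * 6) * bmoa_norm f"
        proof -
          have "ennreal ((LL N + 5) * 6) = ennreal (LL N + 5) * ennreal 6"
            using N by (intro ennreal_mult) auto
          then show ?thesis by (simp only: mult.assoc)
        qed
        also have "\<dots> \<le> ennreal (12 * LL N) * bmoa_norm f"
          using N by (intro mult_right_mono ennreal_leI) auto
        finally show "sup_norm f \<le> ennreal (12 * LL N) * bmoa_norm f" .
      qed
    qed
  qed simp_all
  ultimately show ?thesis unfolding A_def[abs_def] LL_def[abs_def] by blast
qed

end
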